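(* Let $G$ act cocompactly by cubical automorphisms on a CAT$(0)$ cube complex $X$, and let $\mathcal{Q}(G)$ be the collection of stabilizers in $G$ of cubes of $X$. There exists a finite set $F_2\subset\mathcal{Q}(G)^2\times G^2$ such that $1\notin p_1Q_1p_2Q_2$ for every $(Q_1,Q_2,p_1,p_2)\in F_2$, and such that the following holds: if $K\trianglelefteq G$ is co-cubical and $K\cap p_1Q_1p_2Q_2=\emptyset$ for every $(Q_1,Q_2,p_1,p_2)\in F_2$, then every edge-loop of length $2$ in the link of a cube of $X/K$ consists of two $1$--cells lying in the same $G$--orbit.
   Context: A normal subgroup $K\trianglelefteq G$ is co-cubical if $X/K$ is a cube complex; then $G/K$ acts on $X/K$, and $G$--orbits of cells of $X/K$ (and of cells of links of cubes in $X/K$) refer to this induced action. Links of cubes are $\Delta$--complexes with one simplex for each inclusion of the cube into a higher-dimensional cube. *)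

theory Defs
  imports "HOL-Algebra.Algebra"
begin

text \<open>A face of the standard n-cube [0,1]^n is a function assigning to each
coordinate i < n either a fixed value (Some False = 0, Some True = 1) or None
(free coordinate); coordinates \<ge> n are None.\<close>

type_synonym face = "nat \<Rightarrow> bool option"

text \<open>An isometry of the standard n-cube: the point x is sent to y with
y_j = x_(sigma j) xor e_j, sigma a permutation of {0..<n}.\<close>

type_synonym ciso = "(nat \<Rightarrow> nat) \<times> (nat \<Rightarrow> bool)"

definition is_face :: "nat \<Rightarrow> face \<Rightarrow> bool" where
  "is_face n f \<longleftrightarrow> (\<forall>i. n \<le> i \<longrightarrow> f i = None)"

definition fdim :: "nat \<Rightarrow> face \<Rightarrow> nat" where
  "fdim n f = card {i. i < n \<and> f i = None}"

definition is_ciso :: "nat \<Rightarrow> ciso \<Rightarrow> bool" where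
  "is_ciso n phi \<longleftrightarrow> bij_betw (fst phi) {..<n} {..<n}"

definition iact :: "nat \<Rightarrow> ciso \<Rightarrow> face \<Rightarrow> face" where
  "iact n phi f = (\<lambda>j. if j < n then map_option (\<lambda>b. b \<noteq> snd phi j) (f (fst phi j)) else None)"

text \<open>Place a face g of the standard (fdim n f)-cube into the face f of the
n-cube, using the canonical (increasing) identification of the free coordinates.\<close>
definition incl :: "nat \<Rightarrow> face \<Rightarrow> face \<Rightarrow> face" where
  "incl n f g = (\<lambda>i. if i < n then (if f i = None then g (card {k. k < i \<and> f k = None}) else f i)
                     else None)"

text \<open>Inverse of incl: a face h contained in f, expressed in the canonical
coordinates of f.\<close>
definition uninc :: "nat \<Rightarrow> face \<Rightarrow> face \<Rightarrow> face" where
  "uninc n f h = (\<lambda>j. if j < fdim n f then h (filter (\<lambda>i. f i = None) [0..<n] ! j) else None)"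

text \<open>A cube complex: cells, their dimensions, and for every cell c and face f
of its model cube the cell bd c f onto which f is glued together with the gluing
isometry gl c f from the canonical model of f to the model of bd c f.\<close>

record 'c cx =
  cx_cells :: "'c set"
  cx_dim :: "'c \<Rightarrow> nat"
  cx_bd :: "'c \<Rightarrow> face \<Rightarrow> 'c"
  cx_gl :: "'c \<Rightarrow> face \<Rightarrow> ciso"

definition cube_complex :: "'c cx \<Rightarrow> bool" where
  "cube_complex CX \<longleftrightarrow>
    (\<forall>c\<in>cx_cells CX. \<forall>f. is_face (cx_dim CX c) f \<longrightarrow>
        cx_bd CX c f \<in> cx_cells CX \<and> cx_dim CX (cx_bd CX c f) = fdim (cx_dim CX c) f \<and>
        is_ciso (fdim (cx_dim CX c) f) (cx_gl CX c f)) \<and>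
    (\<forall>c\<in>cx_cells CX. cx_bd CX c (\<lambda>_. None) = c \<and>
        (\<forall>g. is_face (cx_dim CX c) g \<longrightarrow> iact (cx_dim CX c) (cx_gl CX c (\<lambda>_. None)) g = g)) \<and>
    (\<forall>c\<in>cx_cells CX. \<forall>f g h. is_face (cx_dim CX c) f \<longrightarrow> is_face (fdim (cx_dim CX c) f) g \<longrightarrow>
        is_face (fdim (fdim (cx_dim CX c) f) g) h \<longrightarrow>
       (let n = cx_dim CX c; k = fdim n f; m = fdim k g; c' = cx_bd CX c f;
            phi = cx_gl CX c f; g' = iact k phi g in
        cx_bd CX c (incl n f g) = cx_bd CX c' g' \<and>
        iact m (cx_gl CX c (incl n f g)) h =
          iact m (cx_gl CX c' g') (uninc k g' (iact k phi (incl k g h)))))"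

definition vtx :: "bool \<Rightarrow> face" where
  "vtx b = (\<lambda>i. if i = 0 then Some b else None)"

type_synonym 'c dedge = "'c \<times> bool"

definition dsrc :: "'c cx \<Rightarrow> 'c dedge \<Rightarrow> 'c" where
  "dsrc CX d = cx_bd CX (fst d) (vtx (snd d))"

definition ddst :: "'c cx \<Rightarrow> 'c dedge \<Rightarrow> 'c" where
  "ddst CX d = cx_bd CX (fst d) (vtx (\<not> snd d))"

definition drev :: "'c dedge \<Rightarrow> 'c dedge" where
  "drev d = (fst d, \<not> snd d)"

definition epath :: "'c cx \<Rightarrow> 'c dedge list \<Rightarrow> bool" where
  "epath CX p \<longleftrightarrow> (\<forall>d\<in>set p. fst d \<in> cx_cells CX \<and> cx_dim CX (fst d) = 1) \<and>
     (\<forall>i. Suc i < length p \<longrightarrow> ddst CX (p ! i) = dsrc CX (p ! Suc i))"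

definition corner2 :: "bool \<Rightarrow> bool \<Rightarrow> face" where
  "corner2 a b = (\<lambda>i. if i = 0 then Some a else if i = 1 then Some b else None)"

definition sq_dedge :: "'c cx \<Rightarrow> 'c \<Rightarrow> face \<Rightarrow> face \<Rightarrow> 'c dedge" where
  "sq_dedge CX s x y =
    (let F = (\<lambda>i. if x i = y i then x i else None) in
     (cx_bd CX s F, (case iact 1 (cx_gl CX s F) (uninc 2 F x) 0 of Some b \<Rightarrow> b | None \<Rightarrow> False)))"

definition sq_loop :: "'c cx \<Rightarrow> 'c \<Rightarrow> bool \<Rightarrow> bool \<Rightarrow> bool \<Rightarrow> 'c dedge list" where
  "sq_loop CX s a b t =
    (let cs = (if t then [corner2 a b, corner2 (\<not>a) b, corner2 (\<not>a) (\<not>b), corner2 a (\<not>b), corner2 a b]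
               else [corner2 a b, corner2 a (\<not>b), corner2 (\<not>a) (\<not>b), corner2 (\<not>a) b, corner2 a b]) in
     map (\<lambda>k. sq_dedge CX s (cs ! k) (cs ! Suc k)) [0..<4])"

definition hstep :: "'c cx \<Rightarrow> 'c dedge list \<Rightarrow> 'c dedge list \<Rightarrow> bool" where
  "hstep CX p q \<longleftrightarrow> epath CX p \<and>
    ((\<exists>u v d. p = u @ [d, drev d] @ v \<and> q = u @ v) \<or>
     (\<exists>u v s a b t. s \<in> cx_cells CX \<and> cx_dim CX s = 2 \<and> p = u @ sq_loop CX s a b t @ v \<and> q = u @ v))"

definition homotopic :: "'c cx \<Rightarrow> 'c dedge list \<Rightarrow> 'c dedge list \<Rightarrow> bool" where
  "homotopic CX = (\<lambda>p q. hstep CX p q \<or> hstep CX q p)\<^sup>*\<^sup>*"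

definition simply_connected :: "'c cx \<Rightarrow> bool" where
  "simply_connected CX \<longleftrightarrow>
    (\<forall>v\<in>cx_cells CX. \<forall>w\<in>cx_cells CX. cx_dim CX v = 0 \<longrightarrow> cx_dim CX w = 0 \<longrightarrow>
       v = w \<or> (\<exists>p. epath CX p \<and> p \<noteq> [] \<and> dsrc CX (hd p) = v \<and> ddst CX (last p) = w)) \<and>
    (\<forall>p. epath CX p \<and> p \<noteq> [] \<and> dsrc CX (hd p) = ddst CX (last p) \<longrightarrow> homotopic CX p [])"

text \<open>Given a face G contained in the face F of the model of d, the pair
(cube bd d F, the face of its model corresponding to G).  This is the inclusion
of the cube bd d G into the cube bd d F, i.e. a simplex of the link of bd d G.\<close>
definition lv :: "'c cx \<Rightarrow> 'c \<Rightarrow> face \<Rightarrow> face \<Rightarrow> 'c \<times> face" where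
  "lv CX d F G = (cx_bd CX d F, iact (fdim (cx_dim CX d) F) (cx_gl CX d F) (uninc (cx_dim CX d) F G))"

text \<open>Simplices of the link of a vertex v: a cube d of dimension \<ge> 1 with a
corner x of its model glued to v.\<close>
definition vsimp :: "'c cx \<Rightarrow> 'c \<Rightarrow> 'c \<times> face \<Rightarrow> bool" where
  "vsimp CX v \<sigma> \<longleftrightarrow> fst \<sigma> \<in> cx_cells CX \<and> 1 \<le> cx_dim CX (fst \<sigma>) \<and>
     is_face (cx_dim CX (fst \<sigma>)) (snd \<sigma>) \<and> (\<forall>i < cx_dim CX (fst \<sigma>). snd \<sigma> i \<noteq> None) \<and>
     cx_bd CX (fst \<sigma>) (snd \<sigma>) = v"

definition svert_map :: "'c cx \<Rightarrow> 'c \<times> face \<Rightarrow> nat \<Rightarrow> 'c \<times> face" where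
  "svert_map CX \<sigma> i = lv CX (fst \<sigma>) ((snd \<sigma>)(i := None)) (snd \<sigma>)"

definition svert :: "'c cx \<Rightarrow> 'c \<times> face \<Rightarrow> ('c \<times> face) set" where
  "svert CX \<sigma> = svert_map CX \<sigma> ` {..<cx_dim CX (fst \<sigma>)}"

definition flag_links :: "'c cx \<Rightarrow> bool" where
  "flag_links CX \<longleftrightarrow> (\<forall>v\<in>cx_cells CX. cx_dim CX v = 0 \<longrightarrow>
     (\<forall>\<sigma>. vsimp CX v \<sigma> \<longrightarrow> inj_on (svert_map CX \<sigma>) {..<cx_dim CX (fst \<sigma>)}) \<and>
     (\<forall>\<sigma> \<tau>. vsimp CX v \<sigma> \<and> vsimp CX v \<tau> \<and> svert CX \<sigma> = svert CX \<tau> \<longrightarrow> \<sigma> = \<tau>) \<and>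
     (\<forall>S. finite S \<and> S \<noteq> {} \<and> (\<forall>u\<in>S. \<forall>w\<in>S. \<exists>\<sigma>. vsimp CX v \<sigma> \<and> svert CX \<sigma> = {u, w})
          \<longrightarrow> (\<exists>\<sigma>. vsimp CX v \<sigma> \<and> svert CX \<sigma> = S)))"

text \<open>CAT(0) cube complex, via Gromov's link condition.\<close>
definition cat0_cube_complex :: "'c cx \<Rightarrow> bool" where
  "cat0_cube_complex CX \<longleftrightarrow> cube_complex CX \<and> simply_connected CX \<and> flag_links CX"

text \<open>act g c is the image cube, aiso g c the isometry from the model of c to
the model of act g c.\<close>
definition cube_action ::
  "('g, 'b) monoid_scheme \<Rightarrow> 'c cx \<Rightarrow> ('g \<Rightarrow> 'c \<Rightarrow> 'c) \<Rightarrow> ('g \<Rightarrow> 'c \<Rightarrow> ciso) \<Rightarrow> bool" where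
  "cube_action G CX act aiso \<longleftrightarrow> group G \<and> cube_complex CX \<and>
    (\<forall>g\<in>carrier G. \<forall>c\<in>cx_cells CX. act g c \<in> cx_cells CX \<and> cx_dim CX (act g c) = cx_dim CX c \<and>
        is_ciso (cx_dim CX c) (aiso g c)) \<and>
    (\<forall>c\<in>cx_cells CX. act \<one>\<^bsub>G\<^esub> c = c \<and>
        (\<forall>f. is_face (cx_dim CX c) f \<longrightarrow> iact (cx_dim CX c) (aiso \<one>\<^bsub>G\<^esub> c) f = f)) \<and>
    (\<forall>g\<in>carrier G. \<forall>h\<in>carrier G. \<forall>c\<in>cx_cells CX.
        act (g \<otimes>\<^bsub>G\<^esub> h) c = act g (act h c) \<and>
        (\<forall>f. is_face (cx_dim CX c) f \<longrightarrow>
           iact (cx_dim CX c) (aiso (g \<otimes>\<^bsub>G\<^esub> h) c) f =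
           iact (cx_dim CX c) (aiso g (act h c)) (iact (cx_dim CX c) (aiso h c) f))) \<and>
    (\<forall>g\<in>carrier G. \<forall>c\<in>cx_cells CX. \<forall>f h. is_face (cx_dim CX c) f \<longrightarrow> is_face (fdim (cx_dim CX c) f) h \<longrightarrow>
       (let n = cx_dim CX c; k = fdim n f; psi = aiso g c; f' = iact n psi f in
        act g (cx_bd CX c f) = cx_bd CX (act g c) f' \<and>
        iact k (aiso g (cx_bd CX c f)) (iact k (cx_gl CX c f) h) =
          iact k (cx_gl CX (act g c) f') (uninc n f' (iact n psi (incl n f h)))))"

definition cocompact :: "('g, 'b) monoid_scheme \<Rightarrow> 'c cx \<Rightarrow> ('g \<Rightarrow> 'c \<Rightarrow> 'c) \<Rightarrow> bool" where
  "cocompact G CX act \<longleftrightarrow> finite ((\<lambda>c. (\<lambda>g. act g c) ` carrier G) ` cx_cells CX)"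

definition cube_stab :: "('g, 'b) monoid_scheme \<Rightarrow> ('g \<Rightarrow> 'c \<Rightarrow> 'c) \<Rightarrow> 'c \<Rightarrow> 'g set" where
  "cube_stab G act c = {g \<in> carrier G. act g c = c}"

definition cube_stabs :: "('g, 'b) monoid_scheme \<Rightarrow> 'c cx \<Rightarrow> ('g \<Rightarrow> 'c \<Rightarrow> 'c) \<Rightarrow> 'g set set" where
  "cube_stabs G CX act = cube_stab G act ` cx_cells CX"

definition prod4 :: "('g, 'b) monoid_scheme \<Rightarrow> 'g \<Rightarrow> 'g set \<Rightarrow> 'g \<Rightarrow> 'g set \<Rightarrow> 'g set" where
  "prod4 G p1 Q1 p2 Q2 = {p1 \<otimes>\<^bsub>G\<^esub> q1 \<otimes>\<^bsub>G\<^esub> p2 \<otimes>\<^bsub>G\<^esub> q2 | q1 q2. q1 \<in> Q1 \<and> q2 \<in> Q2}"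

definition same_orbit ::
  "'g set \<Rightarrow> 'c cx \<Rightarrow> ('g \<Rightarrow> 'c \<Rightarrow> 'c) \<Rightarrow> ('g \<Rightarrow> 'c \<Rightarrow> ciso) \<Rightarrow> 'c \<times> face \<Rightarrow> 'c \<times> face \<Rightarrow> bool" where
  "same_orbit H CX act aiso \<sigma> \<tau> \<longleftrightarrow>
     (\<exists>k\<in>H. act k (fst \<sigma>) = fst \<tau> \<and> iact (cx_dim CX (fst \<sigma>)) (aiso k (fst \<sigma>)) (snd \<sigma>) = snd \<tau>)"

text \<open>K is co-cubical: normal, and CX/K is a cube complex with the induced
structure, i.e. every element of K stabilizing a cube fixes it pointwise.\<close>
definition co_cubical ::
  "('g, 'b) monoid_scheme \<Rightarrow> 'c cx \<Rightarrow> ('g \<Rightarrow> 'c \<Rightarrow> 'c) \<Rightarrow> ('g \<Rightarrow> 'c \<Rightarrow> ciso) \<Rightarrow> 'g set \<Rightarrow> bool" where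
  "co_cubical G CX act aiso K \<longleftrightarrow> normal K G \<and>
     (\<forall>k\<in>K. \<forall>c\<in>cx_cells CX. act k c = c \<longrightarrow>
        (\<forall>f. is_face (cx_dim CX c) f \<longrightarrow> iact (cx_dim CX c) (aiso k c) f = f))"

text \<open>Lifts to CX of the 1-cells of the link of the cube K.c of CX/K: inclusions
of a cube of the K-orbit of c as a codimension-2 face of a cube d.  The
1-cells of that link are the K-orbits of such lifts.\<close>
definition lk1_lift :: "'c cx \<Rightarrow> ('g \<Rightarrow> 'c \<Rightarrow> 'c) \<Rightarrow> 'g set \<Rightarrow> 'c \<Rightarrow> 'c \<times> face \<Rightarrow> bool" where
  "lk1_lift CX act K c \<sigma> \<longleftrightarrow> fst \<sigma> \<in> cx_cells CX \<and> cx_dim CX (fst \<sigma>) = cx_dim CX c + 2 \<and>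
     is_face (cx_dim CX (fst \<sigma>)) (snd \<sigma>) \<and> fdim (cx_dim CX (fst \<sigma>)) (snd \<sigma>) = cx_dim CX c \<and>
     (\<exists>k\<in>K. act k (cx_bd CX (fst \<sigma>) (snd \<sigma>)) = c)"

text \<open>The two endpoints (lifted vertices of the link) of a lifted link 1-cell:
free one of the two fixed coordinates of the face.\<close>
definition lk_end :: "'c cx \<Rightarrow> 'c \<times> face \<Rightarrow> nat \<Rightarrow> 'c \<times> face" where
  "lk_end CX \<sigma> j = lv CX (fst \<sigma>)
      ((snd \<sigma>)(filter (\<lambda>i. snd \<sigma> i \<noteq> None) [0..<cx_dim CX (fst \<sigma>)] ! j := None)) (snd \<sigma>)"

definition two_loops_same_orbit ::
  "('g, 'b) monoid_scheme \<Rightarrow> 'c cx \<Rightarrow> ('g \<Rightarrow> 'c \<Rightarrow> 'c) \<Rightarrow> ('g \<Rightarrow> 'c \<Rightarrow> ciso) \<Rightarrow> 'g set \<Rightarrow> bool" where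
  "two_loops_same_orbit G CX act aiso K \<longleftrightarrow>
    (\<forall>c\<in>cx_cells CX. \<forall>\<sigma>1 \<sigma>2. lk1_lift CX act K c \<sigma>1 \<and> lk1_lift CX act K c \<sigma>2 \<and>
       ((same_orbit K CX act aiso (lk_end CX \<sigma>1 0) (lk_end CX \<sigma>2 0) \<and>
         same_orbit K CX act aiso (lk_end CX \<sigma>1 1) (lk_end CX \<sigma>2 1)) \<or>
        (same_orbit K CX act aiso (lk_end CX \<sigma>1 0) (lk_end CX \<sigma>2 1) \<and>
         same_orbit K CX act aiso (lk_end CX \<sigma>1 1) (lk_end CX \<sigma>2 0)))
     \<longrightarrow> same_orbit (carrier G) CX act aiso \<sigma>1 \<sigma>2)"

end

theory Submission
  imports Defs
begin

text \<open>Let two link edges of X/K share both ends. Lifting them to X and translating by G, they become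
g1 s and g2 t with s, t from a finite set of representatives. Say p carries an end u' of t to an end
u of s and r carries the other end v' of t to the other end v of s. The shared ends provide an element
of K in r^-1 Stab(u) p Stab(v'), so if these products are put into F2
whenever they do not contain 1, this product does contain 1, that is, r = q1 p q2. Then s and q1 p t are
link edges whose end cubes agree.

The stabilizers are those of cubes, and q1, q2 need not preserve the smaller cube c of whose link s is
an edge. But c is the intersection of the two end cubes inside the cube spanned by s, and cubes of a
CAT(0) cube complex are embedded, so the ends of s and q1 p t agree also as link vertices, and they
coincide since links are simplicial.

Embeddedness is a statement about edge paths modulo exchanging two sides of a square. By the flag
condition, if two equivalent paths end in different edges, these edges span a square and the paths can
be pushed across it. Hence letters act by right multiplication (append or cancel) on the classes of
reduced paths, squares act trivially, and by simple connectedness a reduced closed path is empty. A path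
through a cube along distinct coordinates is reduced, so distinct corners of a cube are distinct vertices.\<close>

subsection \<open>Faces of the standard cube\<close>

text \<open>Containment of faces: fixing further coordinates shrinks a face, so the smaller face
  \<open>h\<close> has to repeat every fixed value of \<open>f\<close>.\<close>

definition face_le :: "face \<Rightarrow> face \<Rightarrow> bool" where
  "face_le h f \<longleftrightarrow> (\<forall>i. f i \<noteq> None \<longrightarrow> h i = f i)"

lemma face_le_refl [simp]: "face_le f f"
  by (simp add: face_le_def)

lemma face_le_trans: "face_le h g \<Longrightarrow> face_le g f \<Longrightarrow> face_le h f"
  unfolding face_le_def by (auto simp del: not_None_eq)

lemma face_le_antisym:
  assumes "face_le h f" "face_le f h" shows "h = f"
proof
  fix i
  have "f i \<noteq> None \<longrightarrow> h i = f i" "h i \<noteq> None \<longrightarrow> f i = h i"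
    using assms by (auto simp only: face_le_def)
  then show "h i = f i" by (cases "f i") auto
qed

lemma face_le_upd_None [simp]: "face_le f (f(i := None))"
  by (simp add: face_le_def)

lemma is_face_None [simp]: "is_face n (\<lambda>_. None)"
  by (simp add: is_face_def)

lemma is_face_upd: "is_face n f \<Longrightarrow> i < n \<Longrightarrow> is_face n (f(i := x))"
  by (simp add: is_face_def)

lemma finite_faces: "finite {f. is_face n f}"
proof -
  have "finite {f :: face. \<forall>i. (i \<in> {..<n} \<longrightarrow> f i \<in> UNIV) \<and> (i \<notin> {..<n} \<longrightarrow> f i = None)}"
    by (rule finite_set_of_finite_funs) auto
  then show ?thesis
    by (rule rev_finite_subset) (auto simp: is_face_def)
qed

section \<open>Canonical coordinates on a face\<close>

definition free_rank :: "face \<Rightarrow> nat \<Rightarrow> nat" where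
  "free_rank f i = card {k. k < i \<and> f k = None}"

definition free_nth :: "nat \<Rightarrow> face \<Rightarrow> nat \<Rightarrow> nat" where
  "free_nth n f j = filter (\<lambda>i. f i = None) [0..<n] ! j"

lemma length_filter_upt: "length (filter P [0..<n]) = card {i. i < n \<and> P i}"
proof -
  have "length (filter P [0..<n]) = card (set (filter P [0..<n]))"
    by (rule distinct_card[symmetric]) simp
  then show ?thesis by (simp add: conj_commute)
qed

lemma free_rank_less:
  assumes "i < n" "f i = None" shows "free_rank f i < fdim n f"
  unfolding free_rank_def fdim_def
  by (rule psubset_card_mono) (use assms in auto)

text \<open>\<open>free_rank\<close> and \<open>free_nth\<close> are the two mutually inverse
  increasing numberings hidden in \<open>incl\<close> and \<open>uninc\<close>. Cutting
  \<open>[0..<n]\<close> at \<open>i\<close> shows that exactly \<open>free_rank f i\<close> entries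
  of the filtered list precede \<open>i\<close>.\<close>

lemma free_nth_rank:
  assumes "i < n" "f i = None" shows "free_nth n f (free_rank f i) = i"
proof -
  have "[0..<n] = [0..<i] @ i # [Suc i..<n]"
    using assms(1) upt_add_eq_append[of 0 i "n - i"] upt_conv_Cons[of i n] by simp
  then have "filter (\<lambda>i. f i = None) [0..<n] =
      filter (\<lambda>i. f i = None) [0..<i] @ i # filter (\<lambda>i. f i = None) [Suc i..<n]"
    using assms(2) by simp
  moreover have "free_rank f i = length (filter (\<lambda>i. f i = None) [0..<i])"
    by (simp add: length_filter_upt free_rank_def)
  ultimately show ?thesis unfolding free_nth_def by simp
qed

lemma free_nth:
  assumes "j < fdim n f"
  shows free_nth_less: "free_nth n f j < n" and free_nth_None: "f (free_nth n f j) = None"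
    and free_rank_nth: "free_rank f (free_nth n f j) = j"
proof -
  let ?xs = "filter (\<lambda>i. f i = None) [0..<n]"
  have l: "j < length ?xs" using assms by (simp add: length_filter_upt fdim_def)
  then have "?xs ! j \<in> set ?xs" by (rule nth_mem)
  then show 1: "free_nth n f j < n" and 2: "f (free_nth n f j) = None"
    by (auto simp: free_nth_def)
  have "free_rank f (free_nth n f j) < length ?xs"
    using free_rank_less[of _ n f, OF 1 2] by (simp add: length_filter_upt fdim_def)
  moreover have "?xs ! free_rank f (free_nth n f j) = ?xs ! j"
    using free_nth_rank[of _ n f, OF 1 2] by (simp add: free_nth_def)
  ultimately show "free_rank f (free_nth n f j) = j"
    using l by (simp add: nth_eq_iff_index_eq)
qed

lemma free_rank_mono: "i \<le> i' \<Longrightarrow> free_rank f i \<le> free_rank f i'"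
  unfolding free_rank_def by (rule card_mono) auto

lemma free_rank_strict: "i < i' \<Longrightarrow> f i = None \<Longrightarrow> free_rank f i < free_rank f i'"
  unfolding free_rank_def by (rule psubset_card_mono) auto

lemma incl_eq:
  "incl n f g i = (if i < n then if f i = None then g (free_rank f i) else f i else None)"
  by (simp add: incl_def free_rank_def)

lemma uninc_eq: "uninc n f h j = (if j < fdim n f then h (free_nth n f j) else None)"
  by (simp add: uninc_def free_nth_def)

lemma is_face_incl [simp]: "is_face n (incl n f g)"
  by (simp add: is_face_def incl_eq)

lemma is_face_uninc [simp]: "is_face (fdim n f) (uninc n f h)"
  by (simp add: is_face_def uninc_eq)

lemma face_le_incl: "is_face n f \<Longrightarrow> face_le (incl n f g) f"
  by (auto simp: face_le_def incl_eq is_face_def not_less)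

lemma incl_uninc:
  assumes "is_face n f" "is_face n h" "face_le h f"
  shows "incl n f (uninc n f h) = h"
proof
  fix i show "incl n f (uninc n f h) i = h i"
    using assms free_nth_rank[of i n f] free_rank_less[of i n f]
    by (auto simp: incl_eq uninc_eq is_face_def face_le_def)
qed

lemma uninc_incl:
  assumes "is_face (fdim n f) g" shows "uninc n f (incl n f g) = g"
proof
  fix j show "uninc n f (incl n f g) j = g j"
    using assms free_nth[of j n f] by (auto simp: incl_eq uninc_eq is_face_def)
qed

lemma face_le_incl_iff:
  assumes "is_face (fdim n f) g'"
  shows "face_le (incl n f g) (incl n f g') \<longleftrightarrow> face_le g g'"
proof
  assume L: "face_le (incl n f g) (incl n f g')"
  show "face_le g g'"
    unfolding face_le_def
  proof (intro allI impI)
    fix j assume "g' j \<noteq> None"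
    moreover from this assms have j: "j < fdim n f" by (auto simp: is_face_def not_less[symmetric])
    moreover have "incl n f g'' (free_nth n f j) = g'' j" for g''
      using free_nth[OF j] by (simp add: incl_eq)
    ultimately show "g j = g' j" using L unfolding face_le_def by metis
  qed
qed (auto simp: face_le_def incl_eq)

lemma face_le_uninc_iff:
  assumes "is_face n f" "is_face n h" "is_face n h'" "face_le h f" "face_le h' f"
  shows "face_le (uninc n f h) (uninc n f h') \<longleftrightarrow> face_le h h'"
  using face_le_incl_iff[of n f "uninc n f h'" "uninc n f h"] assms by (simp add: incl_uninc)

lemma fdim_incl: "fdim n (incl n f g) = fdim (fdim n f) g"
proof -
  have "bij_betw (free_rank f) {i. i < n \<and> incl n f g i = None} {j. j < fdim n f \<and> g j = None}"
    by (rule bij_betw_byWitness[where f' = "free_nth n f"])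
      (auto simp: incl_eq free_nth free_nth_rank free_rank_less split: if_splits)
  then show ?thesis by (simp add: fdim_def bij_betw_same_card)
qed

lemma fdim_uninc:
  assumes "is_face n f" "is_face n h" "face_le h f"
  shows "fdim (fdim n f) (uninc n f h) = fdim n h"
  using fdim_incl[of n f "uninc n f h"] assms by (simp add: incl_uninc)

text \<open>The counting fact behind \<open>incl_assoc\<close>: \<open>free_rank f\<close> maps the
  free coordinates of the composite face below \<open>i\<close> bijectively onto the free
  coordinates of \<open>g\<close> below the rank of \<open>i\<close>.\<close>

lemma free_rank_incl:
  assumes "i < n" "f i = None"
  shows "free_rank (incl n f g) i = free_rank g (free_rank f i)"
proof -
  have *: "j < fdim n f \<and> free_nth n f j < i" if "j < free_rank f i" for j
  proof
    show j: "j < fdim n f" using that free_rank_less[of i n f, OF assms] by simp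
    show "free_nth n f j < i"
    proof (rule ccontr)
      assume "\<not> free_nth n f j < i"
      then have "free_rank f i \<le> free_rank f (free_nth n f j)"
        by (intro free_rank_mono) simp
      then show False using free_rank_nth[OF j] that by simp
    qed
  qed
  have A: "k < n \<and> f k = None \<and> g (free_rank f k) = None" if "k < i" "incl n f g k = None" for k
    using that assms(1) by (simp add: incl_eq split: if_splits)
  have B: "incl n f g (free_nth n f j) = g j" if "j < free_rank f i" for j
    using free_nth[of j n f] *[OF that] by (simp add: incl_eq)
  have "bij_betw (free_rank f) {k. k < i \<and> incl n f g k = None} {j. j < free_rank f i \<and> g j = None}"
  proof (rule bij_betw_byWitness[where f' = "free_nth n f"])
    show "\<forall>k\<in>{k. k < i \<and> incl n f g k = None}. free_nth n f (free_rank f k) = k"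
      using A free_nth_rank by blast
    show "\<forall>j\<in>{j. j < free_rank f i \<and> g j = None}. free_rank f (free_nth n f j) = j"
      using * free_rank_nth by blast
    show "free_rank f ` {k. k < i \<and> incl n f g k = None} \<subseteq> {j. j < free_rank f i \<and> g j = None}"
    proof (rule image_subsetI)
      fix k assume "k \<in> {k. k < i \<and> incl n f g k = None}"
      then show "free_rank f k \<in> {j. j < free_rank f i \<and> g j = None}"
        using A[of k] free_rank_strict[of k i f] by simp
    qed
    show "free_nth n f ` {j. j < free_rank f i \<and> g j = None} \<subseteq> {k. k < i \<and> incl n f g k = None}"
      using * B by auto
  qed
  then show ?thesis by (simp add: free_rank_def bij_betw_same_card)
qed

lemma incl_assoc: "incl n f (incl (fdim n f) g h) = incl n (incl n f g) h"
proof
  fix i show "incl n f (incl (fdim n f) g h) i = incl n (incl n f g) h i"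
    using free_rank_less[of i n f] free_rank_incl[of i n f g] by (auto simp: incl_eq)
qed

lemma incl_None: "is_face n g \<Longrightarrow> incl n (\<lambda>_. None) g = g"
  by (auto simp: incl_def is_face_def fun_eq_iff)

lemma fdim_None [simp]: "fdim n (\<lambda>_. None) = n"
  by (simp add: fdim_def)

lemma uninc_None: "is_face n g \<Longrightarrow> uninc n (\<lambda>_. None) g = g"
  using uninc_incl[of n "\<lambda>_. None" g] by (simp add: incl_None)

section \<open>Isometries acting on faces\<close>

lemma is_face_iact [simp]: "is_face n (iact n phi f)"
  by (simp add: is_face_def iact_def)

lemma face_le_iact_iff:
  assumes "is_ciso n phi" "is_face n f"
  shows "face_le (iact n phi h) (iact n phi f) \<longleftrightarrow> face_le h f"
proof
  assume L: "face_le (iact n phi h) (iact n phi f)"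
  show "face_le h f"
    unfolding face_le_def
  proof (intro allI impI)
    fix i assume i: "f i \<noteq> None"
    with assms(2) have "i < n" by (auto simp: is_face_def not_less[symmetric])
    then obtain j where j: "j < n" "i = fst phi j"
      using assms(1) unfolding is_ciso_def bij_betw_def by (metis imageE lessThan_iff)
    have "iact n phi f j \<noteq> None" using i j by (simp add: iact_def)
    then have "iact n phi h j = iact n phi f j" using L unfolding face_le_def by blast
    then have "map_option (\<lambda>b. b \<noteq> snd phi j) (h i) = map_option (\<lambda>b. b \<noteq> snd phi j) (f i)"
      using j by (simp only: iact_def if_True)
    moreover have "inj (\<lambda>b. b \<noteq> snd phi j)" by (auto simp: inj_def)
    ultimately show "h i = f i" using option.inj_map injD by metis
  qed
next
  assume L: "face_le h f"
  show "face_le (iact n phi h) (iact n phi f)"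
    unfolding face_le_def
  proof (intro allI impI)
    fix j assume j: "iact n phi f j \<noteq> None"
    then have "f (fst phi j) \<noteq> None" by (auto simp: iact_def split: if_splits)
    then have "h (fst phi j) = f (fst phi j)" using L unfolding face_le_def by blast
    then show "iact n phi h j = iact n phi f j" by (simp only: iact_def)
  qed
qed

lemma fdim_iact:
  assumes "is_ciso n phi" shows "fdim n (iact n phi f) = fdim n f"
proof -
  have inj: "inj_on (fst phi) {..<n}" and im: "fst phi ` {..<n} = {..<n}"
    using assms by (auto simp: is_ciso_def bij_betw_def)
  have "{j. j < n \<and> iact n phi f j = None} = {j \<in> {..<n}. f (fst phi j) = None}"
    by (auto simp: iact_def)
  then have "fst phi ` {j. j < n \<and> iact n phi f j = None} = fst phi ` {j \<in> {..<n}. f (fst phi j) = None}"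
    by simp
  also have "\<dots> = {i \<in> fst phi ` {..<n}. f i = None}" by auto
  also have "\<dots> = {i. i < n \<and> f i = None}" unfolding im by simp
  finally have "fst phi ` {j. j < n \<and> iact n phi f j = None} = {i. i < n \<and> f i = None}" .
  moreover have "inj_on (fst phi) {j. j < n \<and> iact n phi f j = None}"
    by (rule inj_on_subset[OF inj]) auto
  ultimately show ?thesis
    using card_image[of "fst phi" "{j. j < n \<and> iact n phi f j = None}"] by (simp only: fdim_def)
qed

lemma iact_inj:
  assumes "is_ciso n phi" "is_face n f" "is_face n g" "iact n phi f = iact n phi g"
  shows "f = g"
  using face_le_iact_iff[OF assms(1,2), of g] face_le_iact_iff[OF assms(1,3), of f] assms(4)
  by (simp add: face_le_antisym)

text \<open>Instead of constructing the inverse isometry, use that an injective self-map of the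
  finite set of faces is onto.\<close>

lemma iact_surj:
  assumes "is_ciso n phi" "is_face n g"
  obtains f where "is_face n f" "iact n phi f = g"
proof -
  have "iact n phi ` {f. is_face n f} = {f. is_face n f}"
    by (rule endo_inj_surj[OF finite_faces])
      (use iact_inj[OF assms(1)] in \<open>auto simp: inj_on_def\<close>)
  then have "g \<in> iact n phi ` {f. is_face n f}" using assms(2) by simp
  then obtain f where "is_face n f" "g = iact n phi f" by blast
  then show thesis using that by simp
qed

section \<open>Corners of a cube and steps between adjacent corners\<close>

definition corner :: "nat \<Rightarrow> face \<Rightarrow> bool" where
  "corner n z \<longleftrightarrow> is_face n z \<and> (\<forall>i<n. z i \<noteq> None)"

text \<open>A free coordinate stays free, so \<open>flip\<close> is defined on all faces and
  \<open>tr_index\<close> can be stated for arbitrary \<open>z\<close>.\<close>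

definition flip :: "face \<Rightarrow> nat \<Rightarrow> face" where
  "flip z i = z(i := map_option Not (z i))"

lemma corner_is_face: "corner n z \<Longrightarrow> is_face n z"
  by (simp add: corner_def)

lemma corner_iff: "corner n z \<longleftrightarrow> is_face n z \<and> fdim n z = 0"
  by (auto simp: corner_def fdim_def)

lemma corner_flip: "corner n z \<Longrightarrow> i < n \<Longrightarrow> corner n (flip z i)"
  by (auto simp: corner_def flip_def is_face_def)

lemma flip_commute: "flip (flip z i) j = flip (flip z j) i"
  by (auto simp: flip_def fun_eq_iff)

lemma flip_flip [simp]: "flip (flip z i) i = z"
  by (cases "z i") (auto simp: flip_def fun_eq_iff)

lemma flip_flip_flip [simp]: "flip (flip (flip z i) j) i = flip z j"
  by (metis flip_commute flip_flip)

lemma flip_upd [simp]: "(flip z i)(i := x) = z(i := x)"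
  by (simp add: flip_def)


lemma flip_neq: "corner n z \<Longrightarrow> i < n \<Longrightarrow> flip z i \<noteq> z"
  by (auto simp: flip_def corner_def fun_eq_iff intro!: exI[of _ i])

lemma fdim_upd_None:
  assumes "i < n" "f i \<noteq> None" shows "fdim n (f(i := None)) = Suc (fdim n f)"
proof -
  have "{k. k < n \<and> (f(i := None)) k = None} = insert i {k. k < n \<and> f k = None}"
    using assms by auto
  then show ?thesis using assms by (simp add: fdim_def)
qed

lemma corner_edge:
  assumes "corner n z" "i < n" shows "fdim n (z(i := None)) = 1"
proof -
  have "z i \<noteq> None" using assms by (simp add: corner_def)
  from fdim_upd_None[of i n z, OF assms(2) this] show ?thesis
    using assms(1) by (simp add: corner_iff)
qed

subsection \<open>Words modulo squares\<close>

text \<open>In the intended reading the letters are directed edges, and Sq e f f' e' says that the paths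
e f and f' e' join opposite corners of a square along its two sides.\<close>

locale square_words =
  fixes rv :: "'e \<Rightarrow> 'e" and Sq :: "'e \<Rightarrow> 'e \<Rightarrow> 'e \<Rightarrow> 'e \<Rightarrow> bool"
  assumes rv_rv [simp]: "rv (rv e) = e"
    and Sq_sym: "Sq e f f' e' \<Longrightarrow> Sq f' e' e f"
    and Sq_rot: "Sq e f f' e' \<Longrightarrow> Sq (rv f') e e' (rv f)"
    and Sq_unique: "Sq e f a b \<Longrightarrow> Sq e f a' b' \<Longrightarrow> a = a' \<and> b = b'"
    and Sq_nondeg: "\<not> Sq e (rv e) a b"
    and Sq_cube: "Sq m b n x \<Longrightarrow> Sq b c a d \<Longrightarrow> Sq x c y d' \<Longrightarrow>
      \<exists>w z z'. Sq m a w z \<and> Sq n y w z' \<and> Sq z d z' d'"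
begin

lemma Sq_reverse: "Sq e f f' e' \<Longrightarrow> Sq (rv e') (rv f') (rv f) (rv e)"
  using Sq_rot[OF Sq_rot] .

text \<open>\<open>Sq_unique\<close> says that a square is determined by a path through one of its
  corners. Here the path \<open>c\<close>, \<open>rv d\<close> through the terminal corner is used,
  after reversing and rotating the squares.\<close>

lemma Sq_unique_end:
  assumes "Sq a d b c" "Sq a' d b' c" shows "a = a' \<and> b = b'"
proof -
  have "Sq (rv c) (rv b) (rv d) (rv a)" "Sq (rv c) (rv b') (rv d) (rv a')"
    using assms[THEN Sq_reverse] .
  then have "Sq (rv d) (rv a) (rv c) (rv b)" "Sq (rv d) (rv a') (rv c) (rv b')"
    by (blast dest: Sq_sym)+
  note this[THEN Sq_rot]
  then have "Sq c (rv d) (rv b) a" "Sq c (rv d) (rv b') a'" by simp_all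
  from Sq_unique[OF this] show ?thesis by (metis rv_rv)
qed

lemma Sq_neq_start: "Sq e f f' e' \<Longrightarrow> e \<noteq> f'"
  using Sq_rot Sq_nondeg[of "rv e"] by (metis rv_rv)

lemma Sq_neq_end: "Sq e f f' e' \<Longrightarrow> f \<noteq> e'"
  using Sq_neq_start[OF Sq_reverse] by metis

section \<open>Equivalence under swaps and the diamond property\<close>

inductive swap :: "'e list \<Rightarrow> 'e list \<Rightarrow> bool" where
  swap: "Sq e f f' e' \<Longrightarrow> swap (u @ [e, f] @ v) (u @ [f', e'] @ v)"

definition equiv_words :: "'e list \<Rightarrow> 'e list \<Rightarrow> bool"  (infix "\<asymp>" 50) where
  "p \<asymp> q \<longleftrightarrow> swap\<^sup>*\<^sup>* p q"

lemma eqw_refl [simp]: "p \<asymp> p"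
  by (simp add: equiv_words_def)

lemma eqw_trans [trans]: "p \<asymp> q \<Longrightarrow> q \<asymp> r \<Longrightarrow> p \<asymp> r"
  unfolding equiv_words_def by (rule rtranclp_trans)

lemma swap_sym: "swap p q \<Longrightarrow> swap q p"
  by (metis swap.cases swap.intros Sq_sym)

lemma eqw_sym: "p \<asymp> q \<Longrightarrow> q \<asymp> p"
  unfolding equiv_words_def
  by (metis swap_sym symp_rtranclp sympD sympI)

lemma swap_append:
  assumes "swap p q" shows "swap (u @ p @ v) (u @ q @ v)"
  using assms
proof cases
  case (swap e f f' e' u' v')
  then show ?thesis using swap.intros[of e f f' e' "u @ u'" "v' @ v"] by simp
qed

lemma eqw_append: "p \<asymp> q \<Longrightarrow> u @ p @ v \<asymp> u @ q @ v"
  unfolding equiv_words_def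
  by (induction rule: rtranclp_induct) (auto intro: rtranclp.rtrancl_into_rtrancl swap_append)

lemma eqw_appendR: "p \<asymp> q \<Longrightarrow> p @ v \<asymp> q @ v"
  using eqw_append[of p q "[]"] by simp

lemma eqw_length: "p \<asymp> q \<Longrightarrow> length p = length q"
  unfolding equiv_words_def by (induction rule: rtranclp_induct) (auto elim: swap.cases)

lemma eqw_Sq: "Sq e f f' e' \<Longrightarrow> p @ [e, f] \<asymp> p @ [f', e']"
  unfolding equiv_words_def using swap[of e f f' e' p "[]"] by simp

lemma eqw_Sq_trans: "q \<asymp> p @ [e] \<Longrightarrow> Sq e f f' e' \<Longrightarrow> q @ [f] \<asymp> p @ [f', e']"
  using eqw_trans[OF eqw_appendR[of q "p @ [e]" "[f]"], of "p @ [f', e']"] eqw_Sq[of e f f' e' p]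
  by simp

text \<open>This is the only place where the cube condition, and hence flagness of the links beyond
their being simplicial, is used.\<close>

lemma diamond:
  assumes "Q @ [d] \<asymp> Q' @ [d']"
  shows "d = d' \<and> Q \<asymp> Q' \<or> (\<exists>R x x'. Q \<asymp> R @ [x] \<and> Q' \<asymp> R @ [x'] \<and> Sq x d x' d')"
  using assms
proof (induction "length Q" arbitrary: Q d Q' d' rule: less_induct)
  case less
  have "swap\<^sup>*\<^sup>* (Q @ [d]) (Q' @ [d'])" using less.prems by (simp add: equiv_words_def)
  \<comment> \<open>An inner induction along the swaps, inside the induction on the length of
    \<open>Q\<close>: the claim is stated for every word \<open>w\<close> reached from
    \<open>Q @ [d]\<close>.\<close>
  moreover have "d = c \<and> Q \<asymp> P \<or> (\<exists>R x x'. Q \<asymp> R @ [x] \<and> P \<asymp> R @ [x'] \<and> Sq x d x' c)"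
    if "swap\<^sup>*\<^sup>* (Q @ [d]) w" "w = P @ [c]" for w P c
    using that
  proof (induction arbitrary: P c rule: rtranclp_induct)
    case base
    then show ?case by simp
  next
    case (step w w')
    from step.hyps(2) obtain e f f' e' u v where
      w: "w = u @ [e, f] @ v" and w': "w' = u @ [f', e'] @ v" and sq: "Sq e f f' e'"
      by (auto elim: swap.cases)
    show ?case
    proof (cases v rule: rev_cases)
      case (snoc v' g)
      then have c: "g = c" and P: "P = u @ [f', e'] @ v'"
        using w' step.prems by auto
      have "u @ [e, f] @ v' \<asymp> P"
        unfolding P equiv_words_def using swap[OF sq] by blast
      moreover have "w = (u @ [e, f] @ v') @ [c]" using w snoc c by simp
      ultimately show ?thesis using step.IH[of "u @ [e, f] @ v'" c] by (meson eqw_sym eqw_trans)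
    next
      case Nil
      then have c: "c = e'" and P: "P = u @ [f']" using w' step.prems by auto
      have "w = (u @ [e]) @ [f]" using w Nil by simp
      from step.IH[OF this] show ?thesis
      proof (elim disjE exE conjE)
        assume "d = f" "Q \<asymp> u @ [e]"
        then show ?thesis using sq c P by (metis eqw_refl)
      next
        fix R x x' assume Q: "Q \<asymp> R @ [x]" and R: "u @ [e] \<asymp> R @ [x']" and sq1: "Sq x d x' f"
        have "length u < length Q" using eqw_length[OF Q] eqw_length[OF R] by simp
        \<comment> \<open>The new swap and the square from the inner hypothesis both end in
          \<open>f\<close>. The shorter words \<open>u @ [e]\<close> and \<open>R @ [x']\<close> are
          now compared by the outer hypothesis.\<close>
        from less.hyps[OF this R] show ?thesis
        proof (elim disjE exE conjE)
          assume "e = x'" "u \<asymp> R"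
          \<comment> \<open>Both squares contain the path \<open>e\<close>, \<open>f\<close>, so
            they coincide and the swap leads back to the class of \<open>Q @ [d]\<close>.\<close>
          then have "f' = x" "e' = d" using Sq_unique[OF sq] Sq_sym[OF sq1] by auto
          then show ?thesis using \<open>u \<asymp> R\<close> Q c P by (metis eqw_appendR eqw_sym eqw_trans)
        next
          fix S m n assume u: "u \<asymp> S @ [m]" and R': "R \<asymp> S @ [n]" and "Sq m e n x'"
          \<comment> \<open>Three squares now meet at the corner before \<open>f\<close>; the
            opposite three sides of the cube give the common prefix \<open>S @ [y]\<close>.\<close>
          from Sq_cube[OF this(3) sq Sq_sym[OF sq1]] obtain y z z' where
            y: "Sq m f' y z" "Sq n x y z'" "Sq z e' z' d" by blast
          have "Q \<asymp> (S @ [y]) @ [z']"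
            using eqw_trans[OF Q eqw_Sq_trans[OF R' y(2)]] by simp
          moreover have "P \<asymp> (S @ [y]) @ [z]"
            using eqw_Sq_trans[OF u y(1)] P by simp
          moreover have "Sq z' d z c" using y(3) c Sq_sym by simp
          ultimately show ?thesis by blast
        qed
      qed
    qed
  qed
  ultimately show ?case by blast
qed

text \<open>The other alternative of \<open>diamond\<close> would be a square whose two final edges
  coincide.\<close>

lemma cancel: "Q @ [d] \<asymp> Q' @ [d] \<Longrightarrow> Q \<asymp> Q'"
  using diamond[of Q d Q' d] Sq_neq_end by blast

section \<open>Reduced words and descents\<close>

definition reduced :: "'e list \<Rightarrow> bool" where
  "reduced p \<longleftrightarrow> (\<nexists>u e v. p \<asymp> u @ [e, rv e] @ v)"

definition descent :: "'e list \<Rightarrow> 'e \<Rightarrow> bool" where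
  "descent p e \<longleftrightarrow> (\<exists>q. p \<asymp> q @ [rv e])"

text \<open>\<open>reduced\<close> looks for a backtrack in every equivalent word, since a
  cancellation may become visible only after swaps; it is therefore a property of classes.\<close>

lemma reduced_cong: "p \<asymp> q \<Longrightarrow> reduced p \<longleftrightarrow> reduced q"
  unfolding reduced_def by (meson eqw_sym eqw_trans)

lemma descent_cong: "p \<asymp> q \<Longrightarrow> descent p e \<longleftrightarrow> descent q e"
  unfolding descent_def by (meson eqw_sym eqw_trans)

lemma reduced_Nil: "reduced []"
  unfolding reduced_def using eqw_length by fastforce

lemma reduced_appendD: assumes "reduced (p @ q)" shows "reduced p"
  unfolding reduced_def
proof (intro notI, elim exE)
  fix u e v assume "p \<asymp> u @ [e, rv e] @ v"
  from eqw_appendR[OF this, of q] have "p @ q \<asymp> u @ [e, rv e] @ (v @ q)" by simp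
  then show False using assms unfolding reduced_def by blast
qed

lemma reduced_snocD: assumes "reduced (p @ [e])" shows "\<not> descent p e"
proof
  assume "descent p e"
  then obtain q where "p \<asymp> q @ [rv e]" unfolding descent_def by blast
  from eqw_appendR[OF this, of "[e]"] have "p @ [e] \<asymp> q @ [rv e, rv (rv e)] @ []" by simp
  then show False using assms unfolding reduced_def by blast
qed

text \<open>A backtrack in a word equivalent to \<open>p @ [e]\<close> is pushed back into
  \<open>p\<close> by \<open>diamond\<close>: it yields either a backtrack in a word equivalent to
  \<open>p\<close> or the descent \<open>e\<close> of \<open>p\<close>. If the backtrack is not at
  the end, the induction hypothesis for a shorter prefix of \<open>p\<close> supplies the
  descent.\<close>

lemma reduced_snoc:
  assumes "reduced p" "\<not> descent p e" shows "reduced (p @ [e])"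
  using assms
proof (induction "length p" arbitrary: p e rule: less_induct)
  case less
  show ?case
    unfolding reduced_def
  proof (intro notI, elim exE)
    fix u f v assume uv: "p @ [e] \<asymp> u @ [f, rv f] @ v"
    show False
    proof (cases v rule: rev_cases)
      case Nil
      then have "p @ [e] \<asymp> (u @ [f]) @ [rv f]" using uv by simp
      from diamond[OF this] show False
      proof (elim disjE exE conjE)
        assume "e = rv f" "p \<asymp> u @ [f]"
        then show False using less.prems(2) unfolding descent_def by auto
      next
        fix R x x' assume p: "p \<asymp> R @ [x]" and uf: "u @ [f] \<asymp> R @ [x']" and sq: "Sq x e x' (rv f)"
        from diamond[OF uf] show False
        proof (elim disjE exE conjE)
          assume "f = x'"
          then show False using Sq_sym[OF sq] Sq_nondeg by blast
        next
          fix S m n assume "R \<asymp> S @ [n]" "Sq m f n x'"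
          \<comment> \<open>The two squares share the path \<open>x'\<close>, \<open>rv f\<close>,
            so \<open>x\<close> undoes the last letter \<open>n\<close> of \<open>S @ [n]\<close>,
            and \<open>p\<close> itself backtracks.\<close>
          then have "rv n = x" using Sq_unique[OF Sq_sym[OF Sq_rot] Sq_sym[OF sq]] by blast
          then have "n = rv x" by (metis rv_rv)
          then have "p \<asymp> S @ [rv x, rv (rv x)] @ []"
            using eqw_trans[OF p eqw_appendR[OF \<open>R \<asymp> S @ [n]\<close>]] by simp
          then show False using less.prems(1) unfolding reduced_def by blast
        qed
      qed
    next
      case (snoc v' g)
      then have "p @ [e] \<asymp> (u @ [f, rv f] @ v') @ [g]" using uv by simp
      from diamond[OF this] show False
      proof (elim disjE exE conjE)
        assume "p \<asymp> u @ [f, rv f] @ v'"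
        then show False using less.prems(1) unfolding reduced_def by blast
      next
        fix R x x' assume p: "p \<asymp> R @ [x]" and v: "u @ [f, rv f] @ v' \<asymp> R @ [x']" and sq: "Sq x e x' g"
        have "length R < length p" using eqw_length[OF p] by simp
        moreover have "\<not> reduced (R @ [x'])" unfolding reduced_def using eqw_sym[OF v] by blast
        moreover have "reduced R" using less.prems(1) p reduced_cong reduced_appendD by blast
        \<comment> \<open>\<open>R\<close> is reduced but \<open>R @ [x']\<close> is not, so the
          induction hypothesis makes \<open>x'\<close> a descent of \<open>R\<close>; the rotated
          square then turns this into a descent \<open>e\<close> of \<open>p\<close>.\<close>
        ultimately obtain q where "R \<asymp> q @ [rv x']" using less.hyps unfolding descent_def by blast
        from eqw_Sq_trans[OF this Sq_rot[OF sq]] have "p \<asymp> (q @ [g]) @ [rv e]"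
          using eqw_trans[OF p] by simp
        then show False using less.prems(2) unfolding descent_def by blast
      qed
    qed
  qed
qed

section \<open>Right multiplication by letters\<close>

definition mult :: "'e list \<Rightarrow> 'e \<Rightarrow> 'e list" where
  "mult p e = (if descent p e then SOME q. p \<asymp> q @ [rv e] else p @ [e])"

text \<open>By \<open>cancel\<close>, the choice made by \<open>SOME\<close> in \<open>mult\<close>
  is irrelevant up to equivalence.\<close>

lemma mult_descent: assumes "p \<asymp> q @ [rv e]" shows "mult p e \<asymp> q"
proof -
  have "p \<asymp> mult p e @ [rv e]"
    using assms unfolding mult_def descent_def by (auto intro: someI)
  then show ?thesis using assms by (meson cancel eqw_sym eqw_trans)
qed

lemma mult_nondescent: "\<not> descent p e \<Longrightarrow> mult p e = p @ [e]"
  by (simp add: mult_def)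

lemma mult_cong: assumes "p \<asymp> q" shows "mult p e \<asymp> mult q e"
proof (cases "descent q e")
  case True
  then obtain r where "q \<asymp> r @ [rv e]" unfolding descent_def by blast
  then show ?thesis using assms by (meson mult_descent eqw_sym eqw_trans)
next
  case False
  then show ?thesis using assms descent_cong by (simp add: mult_nondescent eqw_appendR)
qed

lemma reduced_mult: assumes "reduced p" shows "reduced (mult p e)"
proof (cases "descent p e")
  case True
  then obtain r where r: "p \<asymp> r @ [rv e]" unfolding descent_def by blast
  then have "reduced r" using assms reduced_cong reduced_appendD by blast
  then show ?thesis using mult_descent[OF r] reduced_cong by blast
next
  case False
  then show ?thesis using assms by (simp add: mult_nondescent reduced_snoc)
qed

text \<open>If \<open>e\<close> cancels and leaves \<open>r\<close>, then \<open>rv e\<close> cannot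
  cancel in \<open>r\<close>, because \<open>p\<close> would backtrack; so it is appended and
  restores \<open>p\<close>.\<close>

lemma mult_rv: assumes "reduced p" shows "mult (mult p e) (rv e) \<asymp> p"
proof (cases "descent p e")
  case True
  then obtain r where r: "p \<asymp> r @ [rv e]" unfolding descent_def by blast
  then have "\<not> descent r (rv e)" using assms reduced_cong reduced_snocD by blast
  then have "mult r (rv e) \<asymp> p" using r by (simp add: mult_nondescent eqw_sym)
  then show ?thesis using mult_cong[OF mult_descent[OF r]] eqw_trans by blast
next
  case False
  then show ?thesis by (simp add: mult_nondescent mult_descent)
qed

lemma mult_reduced_snoc: "reduced (p @ [e]) \<Longrightarrow> q \<asymp> p \<Longrightarrow> mult q e \<asymp> p @ [e]"
  using mult_cong[of q p e] mult_nondescent reduced_snocD by metis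

text \<open>Four cases, according to whether \<open>e\<close> cancels in \<open>p\<close> and
  \<open>f\<close> cancels in the result. In each, rotations of the square tell how
  \<open>f'\<close> and \<open>e'\<close> behave; in the two mixed cases \<open>diamond\<close> and
  \<open>Sq_unique_end\<close> identify the square that arises with the given one.\<close>

lemma mult_square:
  assumes p: "reduced p" and sq: "Sq e f f' e'"
  shows "mult (mult p e) f \<asymp> mult (mult p f') e'"
proof (cases "descent p e")
  case True
  then obtain q where q: "p \<asymp> q @ [rv e]" unfolding descent_def by blast
  have m: "mult (mult p e) f \<asymp> mult q f" using mult_cong[OF mult_descent[OF q]] .
  show ?thesis
  proof (cases "descent q f")
    case True
    then obtain r where r: "q \<asymp> r @ [rv f]" unfolding descent_def by blast
    have "Sq (rv f) (rv e) (rv e') (rv f')" using Sq_sym[OF Sq_reverse[OF sq]] .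
    then have "p \<asymp> (r @ [rv e']) @ [rv f']"
      using eqw_trans[OF q eqw_Sq_trans[OF r]] by simp
    then have "mult (mult p f') e' \<asymp> r"
      using mult_cong[OF mult_descent] mult_descent[OF eqw_refl] eqw_trans by blast
    then show ?thesis using m mult_descent[OF r] eqw_sym eqw_trans by meson
  next
    case False
    have rot: "Sq (rv e) f' f (rv e')" using Sq_rot[OF Sq_sym[OF sq]] .
    \<comment> \<open>If \<open>f'\<close> cancelled as well, \<open>diamond\<close> would produce
      the given square at the end of \<open>p\<close>, and \<open>f\<close> would be a descent of
      \<open>q\<close>.\<close>
    have "\<not> descent p f'"
    proof
      assume "descent p f'"
      then obtain q' where q': "p \<asymp> q' @ [rv f']" unfolding descent_def by blast
      from diamond[OF eqw_trans[OF eqw_sym[OF q] q']] show False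
      proof (elim disjE exE conjE)
        assume "rv e = rv f'"
        then show False using Sq_neq_start[OF sq] by (metis rv_rv)
      next
        fix R x x' assume "q \<asymp> R @ [x]" "Sq x (rv e) x' (rv f')"
        moreover have "x = rv f"
          using Sq_unique_end[OF calculation(2) Sq_sym[OF Sq_reverse[OF sq]]] by simp
        ultimately show False using False unfolding descent_def by blast
      qed
    qed
    then have "mult p f' \<asymp> (q @ [f]) @ [rv e']"
      using eqw_Sq_trans[OF q rot] by (simp add: mult_nondescent)
    from mult_descent[OF this] show ?thesis
      using m False mult_nondescent eqw_sym eqw_trans by metis
  qed
next
  case nd: False
  then have m: "mult p e = p @ [e]" by (rule mult_nondescent)
  have red: "reduced (p @ [e])" using reduced_snoc[OF p nd] .
  show ?thesis
  proof (cases "descent (p @ [e]) f")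
    case True
    then obtain q where q: "p @ [e] \<asymp> q @ [rv f]" unfolding descent_def by blast
    from diamond[OF this] show ?thesis
    proof (elim disjE exE conjE)
      assume "e = rv f"
      then show ?thesis using sq Sq_nondeg by (metis rv_rv)
    next
      fix R x x' assume R: "p \<asymp> R @ [x]" "q \<asymp> R @ [x']" and "Sq x e x' (rv f)"
      moreover have "Sq (rv f') e e' (rv f)" using Sq_rot[OF sq] .
      ultimately have x: "x = rv f'" "x' = e'" using Sq_unique_end by blast+
      have "reduced q" using red q reduced_cong reduced_appendD by blast
      then have "reduced (R @ [e'])" using R(2) x reduced_cong by simp
      then have "mult (mult p f') e' \<asymp> R @ [e']"
        using R(1) x mult_descent mult_reduced_snoc by simp
      then have "mult (mult p f') e' \<asymp> q" using R(2) x eqw_sym eqw_trans by blast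
      then show ?thesis using m mult_descent[OF q] eqw_sym eqw_trans by metis
    qed
  next
    case False
    then have "mult (mult p e) f = p @ [e, f]" using m by (simp add: mult_nondescent)
    moreover have r: "reduced ((p @ [f']) @ [e'])"
      using reduced_snoc[OF red False] eqw_Sq[OF sq, of p] reduced_cong by simp
    moreover have "mult (mult p f') e' \<asymp> (p @ [f']) @ [e']"
      using mult_reduced_snoc[OF r mult_reduced_snoc[OF reduced_appendD[OF r] eqw_refl]] .
    ultimately show ?thesis
      using eqw_trans[OF eqw_Sq[OF sq, of p] eqw_sym] by simp
  qed
qed

definition mults :: "'e list \<Rightarrow> 'e list \<Rightarrow> 'e list" where
  "mults p w = foldl mult p w"

lemma mults_append: "mults p (u @ v) = mults (mults p u) v"
  by (simp add: mults_def)

lemma mults_cong: "p \<asymp> q \<Longrightarrow> mults p w \<asymp> mults q w"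
proof (induction w arbitrary: p q)
  case (Cons e w)
  from Cons.IH[OF mult_cong[OF Cons.prems]] show ?case by (simp add: mults_def)
qed (simp add: mults_def)

lemma reduced_mults: "reduced p \<Longrightarrow> reduced (mults p w)"
  by (induction w arbitrary: p) (auto simp: mults_def reduced_mult)

lemma mults_backtrack: "reduced p \<Longrightarrow> mults p [e, rv e] \<asymp> p"
  using mult_rv by (simp add: mults_def)

lemma mults_square_loop:
  assumes "reduced p" "Sq e f f' e'" shows "mults p [e, f, rv e', rv f'] \<asymp> p"
proof -
  have "mult (mult (mult (mult p e) f) (rv e')) (rv f')
      \<asymp> mult (mult (mult (mult p f') e') (rv e')) (rv f')"
    by (intro mult_cong mult_square assms)
  also have "\<dots> \<asymp> mult (mult p f') (rv f')"
    by (intro mult_cong mult_rv reduced_mult assms)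
  also have "\<dots> \<asymp> p" by (intro mult_rv assms)
  finally show ?thesis by (simp add: mults_def)
qed

text \<open>A word that acts trivially on all reduced words may be deleted anywhere; this will apply
  to backtracks and to boundaries of squares.\<close>

lemma mults_remove:
  assumes "\<And>p. reduced p \<Longrightarrow> mults p l \<asymp> p" "reduced p"
  shows "mults p (u @ l @ v) \<asymp> mults p (u @ v)"
  unfolding mults_append by (intro mults_cong assms reduced_mults)

lemma mults_reduced: "reduced w \<Longrightarrow> mults [] w \<asymp> w"
proof (induction w rule: rev_induct)
  case (snoc e w)
  then have "mults [] w \<asymp> w" using reduced_appendD by blast
  from mult_reduced_snoc[OF snoc.prems this] show ?case by (simp add: mults_def)
qed (simp add: mults_def)

end

subsection \<open>Edges and squares of a cube complex\<close>

lemma corner_1: "corner 1 x \<Longrightarrow> x = vtx (the (x 0))"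
  by (auto simp: corner_def vtx_def is_face_def fun_eq_iff)

lemma corner_vtx: "corner 1 (vtx b)"
  by (simp add: corner_def vtx_def is_face_def)

lemma vtx_inj: "vtx b = vtx b' \<Longrightarrow> b = b'"
  by (drule fun_cong[of _ _ 0]) (simp add: vtx_def)

lemma vtx_upd: "(vtx b)(0 := None) = (\<lambda>_. None)"
  by (auto simp: vtx_def fun_eq_iff)

text \<open>For \<open>H\<close> contained in \<open>F\<close>, this is \<open>H\<close> read in the
  model of the cell onto which \<open>F\<close> is glued, that is, the second component of
  \<open>lv\<close>.\<close>

definition transport :: "'c cx \<Rightarrow> 'c \<Rightarrow> face \<Rightarrow> face \<Rightarrow> face" where
  "transport CX c F H = iact (fdim (cx_dim CX c) F) (cx_gl CX c F) (uninc (cx_dim CX c) F H)"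

lemma lv_transport: "lv CX c F H = (cx_bd CX c F, transport CX c F H)"
  by (simp add: lv_def transport_def)

locale cube_cx =
  fixes CX :: "'c cx"
  assumes cube_complex: "cube_complex CX"
begin

abbreviation cells where "cells \<equiv> cx_cells CX"
abbreviation dim where "dim \<equiv> cx_dim CX"
abbreviation bd where "bd \<equiv> cx_bd CX"
abbreviation tr where "tr \<equiv> transport CX"

context
  fixes c F assumes c: "c \<in> cells" and F: "is_face (dim c) F"
begin

lemma bd_cells: "bd c F \<in> cells" and dim_bd: "dim (bd c F) = fdim (dim c) F"
  and ciso_gl: "is_ciso (fdim (dim c) F) (cx_gl CX c F)"
  using cube_complex c F unfolding cube_complex_def by blast+

lemma is_face_tr: "is_face (dim (bd c F)) (tr c F H)"
  by (simp add: transport_def dim_bd)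

lemma tr_le_iff:
  assumes "is_face (dim c) H" "is_face (dim c) H'" "face_le H F" "face_le H' F"
  shows "face_le (tr c F H) (tr c F H') \<longleftrightarrow> face_le H H'"
  using assms by (simp add: transport_def face_le_iact_iff[OF ciso_gl] face_le_uninc_iff[OF F])

lemma tr_inj:
  assumes "is_face (dim c) H" "is_face (dim c) H'" "face_le H F" "face_le H' F" "tr c F H = tr c F H'"
  shows "H = H'"
  using tr_le_iff[OF assms(1-4)] tr_le_iff[OF assms(2,1,4,3)] assms(5) by (simp add: face_le_antisym)

lemma fdim_tr:
  assumes "is_face (dim c) H" "face_le H F"
  shows "fdim (dim (bd c F)) (tr c F H) = fdim (dim c) H"
  using assms by (simp add: transport_def dim_bd fdim_iact[OF ciso_gl] fdim_uninc[OF F])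

lemma tr_surj:
  assumes "is_face (dim (bd c F)) g"
  obtains H where "is_face (dim c) H" "face_le H F" "tr c F H = g"
proof -
  obtain h where h: "is_face (fdim (dim c) F) h" "iact (fdim (dim c) F) (cx_gl CX c F) h = g"
    using iact_surj[OF ciso_gl] assms dim_bd by metis
  show thesis
  proof (rule that)
    show "is_face (dim c) (incl (dim c) F h)" by simp
    show "face_le (incl (dim c) F h) F" using F by (rule face_le_incl)
    show "tr c F (incl (dim c) F h) = g" using h by (simp add: transport_def uninc_incl)
  qed
qed

lemma cube_complex_compat:
  assumes "is_face (fdim (dim c) F) g" "is_face (fdim (fdim (dim c) F) g) h"
  defines "g' \<equiv> iact (fdim (dim c) F) (cx_gl CX c F) g"
  shows "bd c (incl (dim c) F g) = bd (bd c F) g'"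
    and "iact (fdim (fdim (dim c) F) g) (cx_gl CX c (incl (dim c) F g)) h =
      iact (fdim (fdim (dim c) F) g) (cx_gl CX (bd c F) g')
        (uninc (fdim (dim c) F) g' (iact (fdim (dim c) F) (cx_gl CX c F) (incl (fdim (dim c) F) g h)))"
  using cube_complex c F assms unfolding cube_complex_def Let_def by metis+

lemma bd_bd:
  assumes "is_face (dim c) H" "face_le H F"
  shows "bd (bd c F) (tr c F H) = bd c H"
  using cube_complex_compat(1)[of "uninc (dim c) F H" "\<lambda>_. None"] assms
  by (simp add: transport_def incl_uninc[OF F])

text \<open>Functoriality of the gluing: passing from \<open>c\<close> to the cell of
  \<open>E\<close> directly or through the cell of \<open>F\<close> gives the same coordinates. It
  is the isometry clause of \<open>cube_complex\<close>, rewritten with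
  \<open>incl_assoc\<close>.\<close>

lemma tr_tr:
  assumes H: "is_face (dim c) H" "face_le H E" and E: "is_face (dim c) E" "face_le E F"
  shows "tr (bd c F) (tr c F E) (tr c F H) = tr c E H"
proof -
  let ?n = "dim c" let ?k = "fdim ?n F" let ?g = "uninc ?n F E" let ?h = "uninc ?n E H"
  have HF: "face_le H F" using H E face_le_trans by blast
  have g: "incl ?n F ?g = E" using E F by (simp add: incl_uninc)
  have k: "fdim ?k ?g = fdim ?n E" using E F by (simp add: fdim_uninc)
  have "incl ?n F (incl ?k ?g ?h) = H"
    using incl_assoc[of ?n F ?g ?h] g H E by (simp add: incl_uninc)
  then have "incl ?k ?g ?h = uninc ?n F H"
    using uninc_incl[of ?n F "incl ?k ?g ?h"] by simp
  then show ?thesis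
    using cube_complex_compat(2)[of ?g ?h] fdim_tr[OF E] g k
    by (simp add: transport_def dim_bd)
qed

text \<open>Translates a free direction \<open>i\<close> of \<open>F\<close> into a direction
  \<open>i'\<close> of the glued cell. The equation recovering \<open>i\<close> from
  \<open>i'\<close> shows that different directions remain different.\<close>

lemma tr_index:
  assumes "i < dim c" "F i = None"
  obtains i' where "i' < dim (bd c F)" "free_nth (dim c) F (fst (cx_gl CX c F) i') = i"
    "\<And>z. tr c F (z(i := None)) = (tr c F z)(i' := None)"
    "\<And>z. tr c F (flip z i) = flip (tr c F z) i'"
proof -
  let ?k = "fdim (dim c) F" let ?s = "fst (cx_gl CX c F)"
  have bij: "bij_betw ?s {..<?k} {..<?k}" using ciso_gl by (simp add: is_ciso_def)
  have "free_rank F i \<in> ?s ` {..<?k}"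
    using bij free_rank_less[of i "dim c" F, OF assms] by (simp add: bij_betw_def)
  then obtain i' where i': "i' < ?k" "?s i' = free_rank F i" by auto
  have n: "free_nth (dim c) F (?s i') = i"
    using i' free_nth_rank[of i "dim c" F] assms by simp
  have eq: "free_nth (dim c) F (?s j) = i \<longleftrightarrow> j = i'" if "j < ?k" for j
  proof
    assume *: "free_nth (dim c) F (?s j) = i"
    have "?s j < ?k" using bij that by (auto simp: bij_betw_def)
    then have "?s j = free_rank F i" using free_rank_nth[of "?s j" "dim c" F] * by simp
    then show "j = i'" using i' bij that by (auto simp: bij_betw_def inj_on_def)
  qed (use n in simp)
  have lt: "?s j < ?k" if "j < ?k" for j using bij that by (auto simp: bij_betw_def)
  have tr_eq: "tr c F z j = (if j < ?k then map_option (\<lambda>b. b \<noteq> snd (cx_gl CX c F) j)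
      (z (free_nth (dim c) F (?s j))) else None)" for z j
    using lt by (simp add: transport_def iact_def uninc_eq)
  show thesis
  proof (rule that)
    show "i' < dim (bd c F)" using i' by (simp add: dim_bd)
    show "free_nth (dim c) F (?s i') = i" by (rule n)
    show "tr c F (z(i := None)) = (tr c F z)(i' := None)" for z
      using eq i'(1) by (auto simp: fun_eq_iff tr_eq)
    show "tr c F (flip z i) = flip (tr c F z) i'" for z
    proof
      fix j show "tr c F (flip z i) j = flip (tr c F z) i' j"
      proof (cases "j = i'")
        case True
        then show ?thesis using n i'(1)
          by (simp add: tr_eq flip_def option.map_comp comp_def cong: map_option_cong)
      next
        case False
        then show ?thesis using eq[of j] by (simp add: tr_eq flip_def)
      qed
    qed
  qed
qed

end

lemma tr_None: "c \<in> cells \<Longrightarrow> is_face (dim c) H \<Longrightarrow> tr c (\<lambda>_. None) H = H"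
  using cube_complex unfolding cube_complex_def transport_def by (simp add: uninc_None)

lemma bd_None: "c \<in> cells \<Longrightarrow> bd c (\<lambda>_. None) = c"
  using cube_complex unfolding cube_complex_def by blast

lemma corner_tr:
  assumes "c \<in> cells" "is_face (dim c) F" "corner (dim c) z" "face_le z F"
  shows "corner (dim (bd c F)) (tr c F z)"
  using assms fdim_tr[of c F z] is_face_tr[of c F z] by (simp add: corner_iff)

text \<open>The edge of \<open>c\<close> that leaves the corner \<open>z\<close> in direction
  \<open>i\<close>. Its orientation bit is the position of \<open>z\<close> in the model of the edge
  cell, which is one-dimensional, so only coordinate 0 is read.\<close>

definition dE :: "'c \<Rightarrow> face \<Rightarrow> nat \<Rightarrow> 'c dedge" where
  "dE c z i = (bd c (z(i := None)), the (tr c (z(i := None)) z 0))"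

lemma fst_dE: "fst (dE c z i) = bd c (z(i := None))"
  by (simp add: dE_def)

text \<open>A directed edge as a vertex of the link of its source, in the format of
  \<open>vsimp\<close> and \<open>svert\<close>.\<close>

definition lnk :: "'c dedge \<Rightarrow> 'c \<times> face" where
  "lnk d = (fst d, vtx (snd d))"

lemma lnk_inj: "lnk d = lnk d' \<Longrightarrow> d = d'"
  by (auto simp: lnk_def prod_eq_iff dest: vtx_inj)

context
  fixes c z i assumes c: "c \<in> cells" and z: "corner (dim c) z" and i: "i < dim c"
begin

lemma edge_face: "is_face (dim c) (z(i := None))"
  using z i by (simp add: corner_def is_face_upd)

lemma dE_cell: "fst (dE c z i) \<in> cells" "dim (fst (dE c z i)) = 1"
  using bd_cells[OF c edge_face] dim_bd[OF c edge_face] corner_edge[OF z i]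
  by (simp_all add: dE_def)

lemma tr_vtx: "tr c (z(i := None)) z = vtx (snd (dE c z i))"
  using corner_1[of "tr c (z(i := None)) z"] corner_tr[OF c edge_face z] dE_cell(2)
  by (simp add: dE_def)

lemma lnk_dE: "lnk (dE c z i) = lv CX c (z(i := None)) z"
  using tr_vtx by (simp add: lnk_def lv_transport fst_dE)

lemma dsrc_dE: "dsrc CX (dE c z i) = bd c z"
proof -
  have "dsrc CX (dE c z i) = bd (bd c (z(i := None))) (tr c (z(i := None)) z)"
    unfolding tr_vtx by (simp add: dsrc_def fst_dE)
  then show ?thesis using bd_bd[OF c edge_face corner_is_face[OF z]] by simp
qed

end

lemma dE_flip:
  assumes "c \<in> cells" "corner (dim c) z" "i < dim c"
  shows "dE c (flip z i) i = drev (dE c z i)"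
proof -
  have f: "corner (dim c) (flip z i)" using assms corner_flip by blast
  have "tr c (z(i := None)) z \<noteq> tr c (z(i := None)) (flip z i)"
    using tr_inj[OF assms(1) edge_face[OF assms], of z "flip z i"] f assms
      corner_is_face flip_neq[of "dim c" z i] face_le_upd_None[of "flip z i" i]
    by fastforce
  then have "snd (dE c z i) \<noteq> snd (dE c (flip z i) i)"
    using tr_vtx[OF assms] tr_vtx[OF assms(1) f assms(3)] by auto
  then show ?thesis by (simp add: drev_def prod_eq_iff fst_dE)
qed

lemma ddst_dE:
  assumes "c \<in> cells" "corner (dim c) z" "i < dim c"
  shows "ddst CX (dE c z i) = bd c (flip z i)"
  using dsrc_dE[OF assms(1) corner_flip[OF assms(2,3)] assms(3)] dE_flip[OF assms]
  by (simp add: dsrc_def ddst_def drev_def)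

text \<open>A directed edge is the same whether it is computed in the cube \<open>c\<close> or in
  the cell of a face containing it; \<open>tr_tr\<close> matches the orientation bits.\<close>

lemma dE_tr:
  assumes c: "c \<in> cells" and F: "is_face (dim c) F" and z: "corner (dim c) z" "face_le z F"
    and i: "i < dim c" "F i = None"
    and i': "tr c F (z(i := None)) = (tr c F z)(i' := None)"
  shows "dE (bd c F) (tr c F z) i' = dE c z i"
proof -
  have L: "is_face (dim c) (z(i := None))" using edge_face[OF c z(1) i(1)] .
  have "face_le (z(i := None)) F" using z(2) i(2) by (auto simp: face_le_def)
  then show ?thesis
    using bd_bd[OF c F L] tr_tr[OF c F corner_is_face[OF z(1)] face_le_upd_None L]
    by (simp add: dE_def i'[symmetric])
qed

text \<open>The square may be a face of a cube \<open>s\<close> of any dimension, so that squares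
  inside larger cubes are immediate from \<open>SqI\<close>; \<open>Sq_square\<close> returns to
  dimension 2.\<close>

definition Sq :: "'c dedge \<Rightarrow> 'c dedge \<Rightarrow> 'c dedge \<Rightarrow> 'c dedge \<Rightarrow> bool" where
  "Sq e f f' e' \<longleftrightarrow> (\<exists>s z i j. s \<in> cells \<and> corner (dim s) z \<and> i < dim s \<and> j < dim s \<and> i \<noteq> j \<and>
     e = dE s z i \<and> f = dE s (flip z i) j \<and> f' = dE s z j \<and> e' = dE s (flip z j) i)"

lemma SqI:
  assumes "s \<in> cells" "corner (dim s) z" "i < dim s" "j < dim s" "i \<noteq> j"
  shows "Sq (dE s z i) (dE s (flip z i) j) (dE s z j) (dE s (flip z j) i)"
  using assms unfolding Sq_def by blast

lemma Sq_sym: "Sq e f f' e' \<Longrightarrow> Sq f' e' e f"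
  unfolding Sq_def by metis

lemma Sq_rot: assumes "Sq e f f' e'" shows "Sq (drev f') e e' (drev f)"
proof -
  obtain s z i j where s: "s \<in> cells" "corner (dim s) z" "i < dim s" "j < dim s" "i \<noteq> j"
    and e: "e = dE s z i" "f = dE s (flip z i) j" "f' = dE s z j" "e' = dE s (flip z j) i"
    using assms unfolding Sq_def by blast
  have z: "corner (dim s) (flip z i)" "corner (dim s) (flip z j)" using s corner_flip by blast+
  have "Sq (dE s (flip z j) j) (dE s z i) (dE s (flip z j) i) (dE s (flip (flip z i) j) j)"
    using SqI[OF s(1) z(2) s(4,3)] s(5) by (simp add: flip_commute[of z j i])
  then show ?thesis
    using e dE_flip[OF s(1,2,4)] dE_flip[OF s(1) z(1) s(4)] by simp
qed

text \<open>Restricts to the 2-face in directions \<open>i\<close> and \<open>j\<close> and bases it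
  at the middle corner \<open>w\<close> of the path \<open>e\<close>, \<open>f\<close>. There
  \<open>drev e\<close> and \<open>f\<close> both start, so the square becomes a simplex of the link
  with these two vertices.\<close>

lemma Sq_square:
  assumes "Sq e f a b"
  obtains s w i j where "s \<in> cells" "dim s = 2" "corner (dim s) w" "i < dim s" "j < dim s" "i \<noteq> j"
    "drev e = dE s w i" "f = dE s w j" "a = dE s (flip w i) j" "b = dE s (flip (flip w i) j) i"
    "dsrc CX f = bd s w"
proof -
  obtain s z i j where s: "s \<in> cells" and z: "corner (dim s) z" and i: "i < dim s"
    and j: "j < dim s" and ij: "i \<noteq> j"
    and e: "e = dE s z i" "f = dE s (flip z i) j" "a = dE s z j" "b = dE s (flip z j) i"
    using assms unfolding Sq_def by blast
  let ?F = "z(i := None, j := None)"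
  have F: "is_face (dim s) ?F" using z i j by (simp add: corner_def is_face_upd)
  have "fdim (dim s) ?F = Suc (fdim (dim s) (z(i := None)))"
    using fdim_upd_None[of j "dim s" "z(i := None)"] z j ij by (simp add: corner_def)
  then have dim2: "dim (bd s ?F) = 2" using dim_bd[OF s F] corner_edge[OF z i] by simp
  obtain i' where i': "i' < dim (bd s ?F)" "free_nth (dim s) ?F (fst (cx_gl CX s ?F) i') = i"
    "\<And>z. tr s ?F (z(i := None)) = (tr s ?F z)(i' := None)"
    "\<And>z. tr s ?F (flip z i) = flip (tr s ?F z) i'"
    by (rule tr_index[OF s F i]) auto
  obtain j' where j': "j' < dim (bd s ?F)" "free_nth (dim s) ?F (fst (cx_gl CX s ?F) j') = j"
    "\<And>z. tr s ?F (z(j := None)) = (tr s ?F z)(j' := None)"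
    "\<And>z. tr s ?F (flip z j) = flip (tr s ?F z) j'"
    by (rule tr_index[OF s F j]) auto
  let ?w = "flip z i"
  have w: "corner (dim s) ?w" "face_le ?w ?F" "corner (dim s) (flip z j)" "face_le (flip z j) ?F"
    "face_le z ?F"
    using corner_flip z i j by (auto simp: face_le_def flip_def)
  show thesis
  proof (rule that)
    show "bd s ?F \<in> cells" by (rule bd_cells[OF s F])
    show "corner (dim (bd s ?F)) (tr s ?F ?w)" by (rule corner_tr[OF s F w(1,2)])
    show "i' \<noteq> j'" using i'(2) j'(2) ij by auto
    show "drev e = dE (bd s ?F) (tr s ?F ?w) i'"
      using dE_tr[OF s F w(1,2) i _ i'(3)] e dE_flip[OF s z i] by simp
    show "f = dE (bd s ?F) (tr s ?F ?w) j'"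
      using dE_tr[OF s F w(1,2) j _ j'(3)] e by simp
    show "a = dE (bd s ?F) (flip (tr s ?F ?w) i') j'"
      using dE_tr[OF s F z w(5) j _ j'(3)] e i'(4) by simp
    show "b = dE (bd s ?F) (flip (flip (tr s ?F ?w) i') j') i'"
      using dE_tr[OF s F w(3,4) i _ i'(3)] e i'(4) j'(4) by simp
    show "dsrc CX f = bd (bd s ?F) (tr s ?F ?w)"
      using dsrc_dE[OF s w(1) j] bd_bd[OF s F corner_is_face[OF w(1)] w(2)] e by simp
  qed (fact dim2 i'(1) j'(1))+
qed

lemma Sq_adj: "Sq e f f' e' \<Longrightarrow> ddst CX e = dsrc CX f"
  unfolding Sq_def by (auto simp: ddst_dE dsrc_dE corner_flip)

lemma svert_map_dE:
  "c \<in> cells \<Longrightarrow> corner (dim c) z \<Longrightarrow> i < dim c \<Longrightarrow> svert_map CX (c, z) i = lnk (dE c z i)"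
  by (simp add: svert_map_def lnk_dE)

lemma svert_dE:
  assumes "c \<in> cells" "corner (dim c) z"
  shows "svert CX (c, z) = (\<lambda>i. lnk (dE c z i)) ` {..<dim c}"
  using svert_map_dE[OF assms] by (auto simp: svert_def)

lemma vsimp_iff:
  "vsimp CX v (c, z) \<longleftrightarrow> c \<in> cells \<and> 1 \<le> dim c \<and> corner (dim c) z \<and> bd c z = v"
  by (auto simp: vsimp_def corner_def)

lemma bd_corner: "c \<in> cells \<Longrightarrow> corner (dim c) z \<Longrightarrow> bd c z \<in> cells \<and> dim (bd c z) = 0"
  using bd_cells dim_bd by (simp add: corner_iff)

lemma vsimp_vertex: "vsimp CX v \<sigma> \<Longrightarrow> v \<in> cells \<and> dim v = 0"
  using bd_corner by (cases \<sigma>) (auto simp only: vsimp_iff)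

lemma Sq_span:
  assumes "Sq e f a b"
  shows "\<exists>\<sigma>. vsimp CX (dsrc CX f) \<sigma> \<and> svert CX \<sigma> = {lnk (drev e), lnk f}"
proof -
  obtain s w i j where s: "s \<in> cells" "dim s = 2" "corner (dim s) w" "i < dim s" "j < dim s" "i \<noteq> j"
    "drev e = dE s w i" "f = dE s w j" "dsrc CX f = bd s w"
    using Sq_square[OF assms] by metis
  have "{..<dim s} = {i, j}" using s by auto
  then have "svert CX (s, w) = {lnk (drev e), lnk f}" using svert_dE[OF s(1,3)] s by simp
  moreover have "vsimp CX (dsrc CX f) (s, w)" using s by (simp add: vsimp_iff)
  ultimately show ?thesis by blast
qed

lemma Sq_dim:
  assumes "Sq e f a b" shows "fst f \<in> cells" "dim (fst f) = 1" "fst e \<in> cells" "dim (fst e) = 1"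
  using assms unfolding Sq_def by (auto simp: dE_cell corner_flip)

lemma edge_span:
  assumes "fst e \<in> cells" "dim (fst e) = 1"
  shows "\<exists>\<sigma>. vsimp CX (dsrc CX e) \<sigma> \<and> svert CX \<sigma> = {lnk e}"
proof -
  have "svert CX (lnk e) = {lnk e}"
    using assms tr_None[OF assms(1), of "vtx (snd e)"] bd_None[OF assms(1)] corner_vtx
    by (simp add: svert_def lnk_def svert_map_def lv_transport vtx_upd corner_def lessThan_Suc)
  moreover have "vsimp CX (dsrc CX e) (lnk e)"
    using assms corner_vtx by (simp add: lnk_def vsimp_iff dsrc_def)
  ultimately show ?thesis by blast
qed

end

section \<open>The conditions on squares, derived from the links\<close>

locale flag_cx = cube_cx CX for CX :: "'c cx" +
  assumes flag: "flag_links CX"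
begin

lemma dE_inj:
  assumes "c \<in> cells" "corner (dim c) z" "i < dim c" "j < dim c" "dE c z i = dE c z j"
  shows "i = j"
proof -
  have "inj_on (svert_map CX (c, z)) {..<dim c}"
    using flag bd_corner[OF assms(1,2)] assms unfolding flag_links_def
    by (metis vsimp_iff fst_conv less_one not_less less_nat_zero_code)
  then show ?thesis
    using assms svert_map_dE[OF assms(1,2)] by (auto simp: inj_on_def)
qed

lemma simplex_unique:
  assumes "vsimp CX v \<sigma>" "vsimp CX v \<tau>" "svert CX \<sigma> = svert CX \<tau>" shows "\<sigma> = \<tau>"
  using vsimp_vertex[OF assms(1)] flag assms unfolding flag_links_def by blast

lemma Sq_nondeg: "\<not> Sq e (drev e) a b"
proof
  assume "Sq e (drev e) a b"
  then obtain s w i j where "s \<in> cells" "corner (dim s) w" "i < dim s" "j < dim s" "i \<noteq> j"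
    "drev e = dE s w i" "drev e = dE s w j"
    by (rule Sq_square) blast
  then show False using dE_inj by metis
qed

text \<open>Based at the middle corner, both squares are simplices of one link with vertices
  \<open>drev e\<close> and \<open>f\<close>, hence equal; \<open>dE_inj\<close> then matches their
  directions.\<close>

lemma Sq_unique:
  assumes "Sq e f a b" "Sq e f a' b'" shows "a = a' \<and> b = b'"
proof -
  obtain s w i j where s: "s \<in> cells" "dim s = 2" "corner (dim s) w" "i < dim s" "j < dim s" "i \<noteq> j"
    "drev e = dE s w i" "f = dE s w j" "a = dE s (flip w i) j" "b = dE s (flip (flip w i) j) i"
    "dsrc CX f = bd s w"
    by (rule Sq_square[OF assms(1)])
  obtain t x k l where t: "t \<in> cells" "dim t = 2" "corner (dim t) x" "k < dim t" "l < dim t" "k \<noteq> l"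
    "drev e = dE t x k" "f = dE t x l" "a' = dE t (flip x k) l" "b' = dE t (flip (flip x k) l) k"
    "dsrc CX f = bd t x"
    by (rule Sq_square[OF assms(2)])
  have "{..<dim s} = {i, j}" "{..<dim t} = {k, l}" using s t by auto
  then have "svert CX (s, w) = {lnk (drev e), lnk f}" "svert CX (t, x) = {lnk (drev e), lnk f}"
    unfolding svert_dE[OF s(1,3)] svert_dE[OF t(1,3)] by (simp_all add: s(7,8) t(7,8)[symmetric])
  then have "svert CX (s, w) = svert CX (t, x)" by simp
  moreover have "vsimp CX (dsrc CX f) (s, w)" "vsimp CX (dsrc CX f) (t, x)"
    using s t by (simp_all add: vsimp_iff)
  ultimately have st: "s = t" "w = x" using simplex_unique by blast+
  then have ij: "i = k" "j = l"
    using dE_inj[OF s(1,3)] s(4,5,7,8) t(4,5,7,8) by metis+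
  show ?thesis unfolding s(9,10) t(9,10) st ij by simp
qed

text \<open>The edges \<open>drev b\<close>, \<open>drev x\<close> and \<open>c\<close> leave the
  common corner and pairwise span squares, so flagness gives a cube \<open>q\<close> containing all
  three. \<open>Sq_unique\<close> identifies the given squares with faces of \<open>q\<close>, and
  the opposite faces are the squares wanted.\<close>

lemma Sq_cube:
  assumes "Sq m b n x" "Sq b c a d" "Sq x c y d'"
  shows "\<exists>w z z'. Sq m a w z \<and> Sq n y w z' \<and> Sq z d z' d'"
proof -
  let ?v = "dsrc CX c" let ?S = "{lnk (drev b), lnk (drev x), lnk c}"
  have bx: "Sq x (drev b) (drev n) m" using Sq_sym[OF Sq_rot[OF assms(1)]] .
  have src: "dsrc CX (drev b) = ?v" "dsrc CX (drev x) = ?v"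
    using Sq_adj[OF assms(2)] Sq_adj[OF assms(3)] by (simp_all add: dsrc_def ddst_def drev_def)
  \<comment> \<open>The flag condition also ranges over pairs with \<open>u = w\<close>, for which
    the edge itself is the simplex.\<close>
  have one: "\<exists>\<sigma>. vsimp CX ?v \<sigma> \<and> svert CX \<sigma> = {lnk e}" if "e \<in> {drev b, drev x, c}" for e
    using that src edge_span[of e] Sq_dim[OF assms(2)] Sq_dim[OF assms(3)]
    by (auto simp: drev_def)
  have two: "\<exists>\<sigma>. vsimp CX ?v \<sigma> \<and> svert CX \<sigma> = {lnk (drev b), lnk c}"
    "\<exists>\<sigma>. vsimp CX ?v \<sigma> \<and> svert CX \<sigma> = {lnk (drev x), lnk c}"
    "\<exists>\<sigma>. vsimp CX ?v \<sigma> \<and> svert CX \<sigma> = {lnk (drev x), lnk (drev b)}"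
    using Sq_span[OF assms(2)] Sq_span[OF assms(3)] Sq_span[OF bx] src by auto
  have pairs: "\<forall>u\<in>?S. \<forall>w\<in>?S. \<exists>\<sigma>. vsimp CX ?v \<sigma> \<and> svert CX \<sigma> = {u, w}"
    using one two by (simp add: insert_commute)
  have v: "?v \<in> cells" "dim ?v = 0"
    using two(1) vsimp_vertex by blast+
  have "\<exists>\<sigma>. vsimp CX ?v \<sigma> \<and> svert CX \<sigma> = ?S"
    using flag v pairs unfolding flag_links_def by (metis finite.emptyI finite_insert insert_not_empty)
  then obtain q w where q: "q \<in> cells" "corner (dim q) w" and S: "svert CX (q, w) = ?S"
    by (auto simp: vsimp_iff)
  have idx: "\<exists>i<dim q. e = dE q w i" if "lnk e \<in> ?S" for e
    using that S svert_dE[OF q] lnk_inj by blast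
  obtain i j k where i: "i < dim q" "drev b = dE q w i" and j: "j < dim q" "drev x = dE q w j"
    and k: "k < dim q" "c = dE q w k"
    using idx[of "drev b"] idx[of "drev x"] idx[of c] by auto
  have "drev b \<noteq> c" "drev x \<noteq> c" "drev x \<noteq> drev b"
    using Sq_nondeg assms(2,3) bx by metis+
  then have ne: "i \<noteq> j" "i \<noteq> k" "j \<noteq> k" using i j k by auto
  note cf = corner_flip[OF q(2)] corner_flip[OF corner_flip[OF q(2)]]
    corner_flip[OF corner_flip[OF corner_flip[OF q(2)]]]
  have b: "b = dE q (flip w i) i" and x: "x = dE q (flip w j) j"
    using dE_flip[OF q i(1)] dE_flip[OF q j(1)] i(2)[symmetric] j(2)[symmetric]
    by (simp_all add: drev_def)
  \<comment> \<open>The corner of \<open>q\<close> where \<open>m\<close> and \<open>n\<close>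
    start, opposite to \<open>w\<close> in the square of \<open>b\<close> and
    \<open>x\<close>.\<close>
  let ?z = "flip (flip w i) j"
  have ad: "a = dE q (flip w i) k \<and> d = dE q (flip (flip w i) k) i"
    using Sq_unique[OF assms(2)] SqI[OF q(1) cf(1)[OF i(1)] i(1) k(1) ne(2)] b k(2) by simp
  have yd: "y = dE q (flip w j) k \<and> d' = dE q (flip (flip w j) k) j"
    using Sq_unique[OF assms(3)] SqI[OF q(1) cf(1)[OF j(1)] j(1) k(1) ne(3)] x k(2) by simp
  have "Sq (dE q ?z j) b (dE q ?z i) x"
    using SqI[OF q(1) cf(2)[OF i(1) j(1)] j(1) i(1)] ne(1) b x by simp
  then have "Sq x (drev b) (drev (dE q ?z i)) (dE q ?z j)" using Sq_sym[OF Sq_rot] by blast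
  then have "drev n = drev (dE q ?z i) \<and> m = dE q ?z j" using Sq_unique[OF bx] by blast
  then have mn: "m = dE q ?z j" "n = dE q ?z i" by (auto simp: drev_def prod_eq_iff)
  have "Sq m a (dE q ?z k) (dE q (flip ?z k) j)"
    using SqI[OF q(1) cf(2)[OF i(1) j(1)] j(1) k(1) ne(3)] mn ad by simp
  moreover have "Sq n y (dE q ?z k) (dE q (flip ?z k) i)"
    using SqI[OF q(1) cf(2)[OF i(1) j(1)] i(1) k(1) ne(2)] mn yd by simp
  moreover have "Sq (dE q (flip ?z k) j) d (dE q (flip ?z k) i) d'"
    using SqI[OF q(1) cf(3)[OF i(1) j(1) k(1)] j(1) i(1)] ne(1) ad yd
      flip_commute[of "flip w i" j k] flip_commute[of "flip w j" i k] flip_commute[of w i j] by simp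
  ultimately show ?thesis by blast
qed

sublocale square_words drev Sq
proof
  show "drev (drev e) = e" for e :: "'c dedge" by (simp add: drev_def)
qed (fact Sq_sym Sq_rot Sq_unique Sq_nondeg Sq_cube)+

end

subsection \<open>Cubes are embedded\<close>

context flag_cx
begin

lemma sq_dedge_dE:
  assumes "s \<in> cells" "dim s = 2" "corner 2 x" "i < 2"
  shows "sq_dedge CX s x (flip x i) = dE s x i"
proof -
  have F: "(\<lambda>k. if x k = flip x i k then x k else None) = x(i := None)"
    using assms(3,4) by (auto simp: flip_def fun_eq_iff corner_def)
  have "iact 1 (cx_gl CX s (x(i := None))) (uninc 2 (x(i := None)) x) = vtx (snd (dE s x i))"
    using tr_vtx[of s x i] corner_edge[of 2 x i] assms by (simp add: transport_def)
  then show ?thesis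
    unfolding sq_dedge_def Let_def F by (simp add: prod_eq_iff fst_dE vtx_def)
qed

lemma corner2_flip:
  "corner 2 (corner2 a b)" "corner2 (\<not> a) b = flip (corner2 a b) 0" "corner2 a (\<not> b) = flip (corner2 a b) 1"
  by (auto simp: corner2_def corner_def is_face_def flip_def fun_eq_iff)

text \<open>In both orientations the loop has the shape treated by \<open>mults_square_loop\<close>:
  its last two sides run backwards along the other path, and \<open>t\<close> only decides which
  coordinate is flipped first.\<close>

lemma sq_loop_Sq:
  assumes "s \<in> cells" "dim s = 2"
  obtains e f f' e' where "Sq e f f' e'" "sq_loop CX s a b t = [e, f, drev e', drev f']"
proof -
  let ?z = "corner2 a b"
  have z: "corner 2 ?z" "corner 2 (flip ?z 0)" "corner 2 (flip ?z 1)" "corner 2 (flip (flip ?z 0) 1)"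
    using corner2_flip(1) corner_flip by auto
  have loop: "map (\<lambda>k. sq_dedge CX s (cs ! k) (cs ! Suc k)) [0..<4] =
      [dE s ?z i, dE s (flip ?z i) j, drev (dE s (flip ?z j) i), drev (dE s ?z j)]"
    if cs: "cs = [?z, flip ?z i, flip (flip ?z i) j, flip ?z j, ?z]"
      and ij: "i = 0 \<and> j = 1 \<or> i = 1 \<and> j = 0" for cs i j
  proof -
    have zi: "corner 2 (flip ?z i)" "corner 2 (flip ?z j)" "corner 2 (flip (flip ?z i) j)"
      using ij z(1) corner_flip by auto
    have "flip ?z j = flip (flip (flip ?z i) j) i" "?z = flip (flip ?z j) j" by simp_all
    then have "sq_dedge CX s (flip (flip ?z i) j) (flip ?z j) = dE s (flip (flip ?z j) i) i"
      "sq_dedge CX s (flip ?z j) ?z = dE s (flip ?z j) j"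
      using sq_dedge_dE[OF assms zi(3), of i] sq_dedge_dE[OF assms zi(2), of j] ij
      by (auto simp: flip_commute)
    moreover have "[0..<4] = [0, 1, 2, 3::nat]" by (simp add: upt_rec)
    ultimately show ?thesis
      using cs ij sq_dedge_dE[OF assms z(1), of i] sq_dedge_dE[OF assms zi(1), of j]
        dE_flip[of s "flip ?z j" i] dE_flip[of s ?z j] assms zi z(1)
      by (auto simp: numeral_2_eq_2 numeral_3_eq_3)
  qed
  have "Sq (dE s ?z i) (dE s (flip ?z i) j) (dE s ?z j) (dE s (flip ?z j) i)"
    if "i = 0 \<and> j = 1 \<or> i = 1 \<and> j = 0" for i j
    using SqI[of s ?z i j] assms z that by auto
  moreover let ?cs = "\<lambda>i j. [?z, flip ?z i, flip (flip ?z i) j, flip ?z j, ?z]"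
    and ?loop = "\<lambda>i j. [dE s ?z i, dE s (flip ?z i) j, drev (dE s (flip ?z j) i), drev (dE s ?z j)]"
  have "sq_loop CX s a b t = ?loop 0 1 \<or> sq_loop CX s a b t = ?loop 1 0"
  proof (cases t)
    case True
    have "sq_loop CX s a b t = map (\<lambda>k. sq_dedge CX s (?cs 0 1 ! k) (?cs 0 1 ! Suc k)) [0..<4]"
      unfolding sq_loop_def Let_def
      by (simp only: True if_True corner2_flip(2,3) flip_commute[of ?z 1 0])
    also have "\<dots> = ?loop 0 1" by (rule loop) auto
    finally show ?thesis by blast
  next
    case False
    have "sq_loop CX s a b t = map (\<lambda>k. sq_dedge CX s (?cs 1 0 ! k) (?cs 1 0 ! Suc k)) [0..<4]"
      unfolding sq_loop_def Let_def
      by (simp only: False if_False corner2_flip(2,3) flip_commute[of ?z 0 1])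
    also have "\<dots> = ?loop 1 0" by (rule loop) auto
    finally show ?thesis by blast
  qed
  ultimately show thesis using that by blast
qed

text \<open>Each elementary homotopy inserts or deletes a backtrack or the boundary of a square, and
  both act trivially on reduced words.\<close>

lemma homotopic_mults:
  assumes "homotopic CX p q" "reduced r" shows "equiv_words (mults r p) (mults r q)"
proof -
  have step: "equiv_words (mults r p) (mults r q)" if st: "hstep CX p q" for p q
  proof -
    consider u v d where "p = u @ [d, drev d] @ v" "q = u @ v"
      | u v s a b t where "s \<in> cells" "dim s = 2" "p = u @ sq_loop CX s a b t @ v" "q = u @ v"
      using st unfolding hstep_def by blast
    then show ?thesis
    proof cases
      case 1
      then show ?thesis using mults_remove[OF mults_backtrack assms(2)] by blast
    next
      case (2 u v s a b t)
      obtain e f f' e' where "Sq e f f' e'" "sq_loop CX s a b t = [e, f, drev e', drev f']"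
        by (rule sq_loop_Sq[OF 2(1,2)])
      then show ?thesis
        using mults_remove[OF mults_square_loop assms(2)] 2(3,4) by metis
    qed
  qed
  show ?thesis
    using assms(1) unfolding homotopic_def
  proof (induction rule: rtranclp_induct)
    case (step q q')
    then have "equiv_words (mults r q) (mults r q')" using \<open>\<And>p q. hstep CX p q \<Longrightarrow> equiv_words (mults r p) (mults r q)\<close> eqw_sym by blast
    then show ?case using step.IH eqw_trans by blast
  qed simp
qed

section \<open>Paths inside a single cube\<close>

fun cube_path :: "'c \<Rightarrow> face \<Rightarrow> nat list \<Rightarrow> 'c dedge list" where
  "cube_path c z [] = []"
| "cube_path c z (i # is) = dE c z i # cube_path c (flip z i) is"

lemma length_cube_path [simp]: "length (cube_path c z is) = length is"
  by (induction "is" arbitrary: z) auto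

lemma cube_path_append: "cube_path c z (is @ js) = cube_path c z is @ cube_path c (foldl flip z is) js"
  by (induction "is" arbitrary: z) auto

lemma corner_foldl_flip:
  "corner n z \<Longrightarrow> set is \<subseteq> {..<n} \<Longrightarrow> corner n (foldl flip z is)"
  by (induction "is" arbitrary: z) (auto simp: corner_flip)

lemma cube_path_split:
  assumes "cube_path c z is = u @ [e, f] @ v"
  obtains us i j vs where "is = us @ [i, j] @ vs" "u = cube_path c z us"
    "e = dE c (foldl flip z us) i" "f = dE c (flip (foldl flip z us) i) j"
    "v = cube_path c (flip (flip (foldl flip z us) i) j) vs"
proof -
  let ?k = "length u"
  have len: "length is = ?k + 2 + length v"
    using arg_cong[OF assms, of length] by simp
  define us where "us = take ?k is"
  have "length (drop ?k is) \<ge> 2" using len by simp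
  then obtain i j vs where d: "drop ?k is = i # j # vs"
    by (metis Suc_le_length_iff numeral_2_eq_2)
  have "is": "is = us @ [i, j] @ vs" using d unfolding us_def by (metis append_Cons append_Nil append_take_drop_id)
  have "length us = ?k" using len by (simp add: us_def)
  then have "length (cube_path c z us) = length u" by simp
  moreover have "cube_path c z us @ cube_path c (foldl flip z us) ([i, j] @ vs) = u @ [e, f] @ v"
    using assms unfolding "is" cube_path_append .
  ultimately have "cube_path c z us = u" "cube_path c (foldl flip z us) ([i, j] @ vs) = [e, f] @ v"
    using append_eq_append_conv by blast+
  then show thesis using that "is" by auto
qed

context
  fixes c z assumes c: "c \<in> cells" and z: "corner (dim c) z"
begin

text \<open>By \<open>Sq_unique\<close> the square of two consecutive edges is the one inside the
  cube, so a swap merely transposes two directions.\<close>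

lemma swap_cube_path:
  assumes "swap (cube_path c z is) q" "distinct is" "set is \<subseteq> {..<dim c}"
  shows "\<exists>js. q = cube_path c z js \<and> distinct js \<and> set js \<subseteq> {..<dim c}"
proof -
  obtain u e f f' e' v where p: "cube_path c z is = u @ [e, f] @ v" and q: "q = u @ [f', e'] @ v"
    and sq: "Sq e f f' e'" using assms(1) by (auto elim: swap.cases)
  obtain us i j vs where s: "is = us @ [i, j] @ vs" "u = cube_path c z us"
    "e = dE c (foldl flip z us) i" "f = dE c (flip (foldl flip z us) i) j"
    "v = cube_path c (flip (flip (foldl flip z us) i) j) vs"
    by (rule cube_path_split[OF p])
  have "corner (dim c) (foldl flip z us)" using corner_foldl_flip[OF z] assms(3) s(1) by auto
  then have "Sq e f (dE c (foldl flip z us) j) (dE c (flip (foldl flip z us) j) i)"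
    using SqI[OF c] s assms(2,3) by auto
  then have "q = cube_path c z (us @ [j, i] @ vs)"
    using Sq_unique[OF sq] q s(2,5) by (simp add: cube_path_append flip_commute[of _ i j])
  moreover have "distinct (us @ [j, i] @ vs)" "set (us @ [j, i] @ vs) \<subseteq> {..<dim c}"
    using assms(2,3) s(1) by auto
  ultimately show ?thesis by blast
qed

text \<open>Every equivalent word is again a path along distinct directions; a backtrack in it would
  be a pair \<open>e\<close>, \<open>drev e\<close> spanning a square, against
  \<open>Sq_nondeg\<close>.\<close>

lemma reduced_cube_path:
  assumes "distinct is" "set is \<subseteq> {..<dim c}" shows "reduced (cube_path c z is)"
  unfolding reduced_def
proof (intro notI, elim exE)
  fix u e v assume "equiv_words (cube_path c z is) (u @ [e, drev e] @ v)"
  then have "swap\<^sup>*\<^sup>* (cube_path c z is) (u @ [e, drev e] @ v)" by (simp add: equiv_words_def)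
  then have "\<exists>js. u @ [e, drev e] @ v = cube_path c z js \<and> distinct js \<and> set js \<subseteq> {..<dim c}"
    by (induction rule: rtranclp_induct) (use assms swap_cube_path in blast)+
  then obtain js where js: "cube_path c z js = u @ [e, drev e] @ v" "distinct js" "set js \<subseteq> {..<dim c}"
    by metis
  obtain us i j vs where s: "js = us @ [i, j] @ vs"
    "e = dE c (foldl flip z us) i" "drev e = dE c (flip (foldl flip z us) i) j"
    by (rule cube_path_split[OF js(1)])
  have "corner (dim c) (foldl flip z us)" using corner_foldl_flip[OF z] js(3) s(1) by auto
  then have "Sq e (drev e) (dE c (foldl flip z us) j) (dE c (flip (foldl flip z us) j) i)"
    using SqI[OF c] s js by auto
  then show False using Sq_nondeg by blast
qed

end

lemma epath_Cons:
  "epath CX (d # p) \<longleftrightarrow> fst d \<in> cells \<and> dim (fst d) = 1 \<and> (p \<noteq> [] \<longrightarrow> ddst CX d = dsrc CX (hd p)) \<and> epath CX p"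
proof -
  have all_split: "(\<forall>i. Q i) \<longleftrightarrow> Q 0 \<and> (\<forall>i. Q (Suc i))" for Q :: "nat \<Rightarrow> bool"
    by (metis not0_implies_Suc)
  have "(\<forall>i. Suc i < length (d # p) \<longrightarrow> ddst CX ((d # p) ! i) = dsrc CX ((d # p) ! Suc i)) \<longleftrightarrow>
    (p \<noteq> [] \<longrightarrow> ddst CX d = dsrc CX (hd p)) \<and>
    (\<forall>i. Suc i < length p \<longrightarrow> ddst CX (p ! i) = dsrc CX (p ! Suc i))"
    by (subst all_split) (auto simp: hd_conv_nth)
  then show ?thesis by (auto simp: epath_def)
qed

lemma cube_path_epath:
  assumes "c \<in> cells" "corner (dim c) z" "set is \<subseteq> {..<dim c}"
  shows "epath CX (cube_path c z is) \<and>
    (is \<noteq> [] \<longrightarrow> dsrc CX (hd (cube_path c z is)) = bd c z \<and>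
      ddst CX (last (cube_path c z is)) = bd c (foldl flip z is))"
  using assms(2,3)
proof (induction "is" arbitrary: z)
  case Nil
  then show ?case by (simp add: epath_def)
next
  case (Cons i "is")
  then have IH: "epath CX (cube_path c (flip z i) is) \<and>
    (is \<noteq> [] \<longrightarrow> dsrc CX (hd (cube_path c (flip z i) is)) = bd c (flip z i) \<and>
      ddst CX (last (cube_path c (flip z i) is)) = bd c (foldl flip (flip z i) is))"
    using corner_flip by simp
  have i: "i < dim c" using Cons.prems by simp
  have ne: "cube_path c (flip z i) is = [] \<longleftrightarrow> is = []" by (cases "is") auto
  show ?case
    using IH ne dE_cell[OF assms(1) Cons.prems(1) i] dsrc_dE[OF assms(1) Cons.prems(1) i]
      ddst_dE[OF assms(1) Cons.prems(1) i]
    by (auto simp: epath_Cons)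
qed

lemma foldl_flip:
  "distinct is \<Longrightarrow> foldl flip z is = (\<lambda>k. if k \<in> set is then map_option Not (z k) else z k)"
  by (induction "is" arbitrary: z) (auto simp: flip_def fun_eq_iff)

end

locale cat0_cx = flag_cx CX for CX :: "'c cx" +
  assumes simply_connected: "simply_connected CX"
begin

text \<open>Acting on the empty word, a reduced \<open>p\<close> gives \<open>p\<close> up to
  equivalence, whereas a null-homotopic one gives the empty word; equivalent words have equal
  length.\<close>

lemma reduced_closed_path:
  assumes "epath CX p" "reduced p" "p \<noteq> []" shows "dsrc CX (hd p) \<noteq> ddst CX (last p)"
proof
  assume "dsrc CX (hd p) = ddst CX (last p)"
  then have "homotopic CX p []" using simply_connected assms unfolding simply_connected_def by blast
  then have "equiv_words (mults [] p) (mults [] [])" using homotopic_mults reduced_Nil by blast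
  then have "equiv_words p []" using mults_reduced[OF assms(2)] eqw_sym eqw_trans by (metis foldl_Nil mults_def)
  then show False using eqw_length assms(3) by fastforce
qed

lemma bd_inj_corner:
  assumes "c \<in> cells" "corner (dim c) z" "corner (dim c) z'" "bd c z = bd c z'" shows "z = z'"
proof (rule ccontr)
  assume ne: "z \<noteq> z'"
  \<comment> \<open>The directions in which the corners differ: flipping them in turn leads from
    \<open>z\<close> to \<open>z'\<close>.\<close>
  define "is" where "is = filter (\<lambda>k. z k \<noteq> z' k) [0..<dim c]"
  have d: "distinct is" "set is \<subseteq> {..<dim c}" "set is = {k. k < dim c \<and> z k \<noteq> z' k}"
    by (auto simp: is_def)
  obtain k where k: "z k \<noteq> z' k" using ne by auto
  then have "k < dim c"
    using assms(2,3) by (metis corner_def is_face_def not_less)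
  then have "k \<in> set is" using k by (simp add: d(3))
  then have ne: "is \<noteq> []" by auto
  have "foldl flip z is = z'"
  proof
    fix k show "foldl flip z is k = z' k"
    proof (cases "k < dim c")
      case True
      then obtain a b where "z k = Some a" "z' k = Some b"
        using assms(2,3) unfolding corner_def by blast
      then show ?thesis using foldl_flip[OF d(1)] d(3) True by auto
    next
      case False
      then show ?thesis using foldl_flip[OF d(1)] d(3) assms(2,3)
        by (simp add: corner_def is_face_def)
    qed
  qed
  then show False
    using reduced_closed_path[OF _ reduced_cube_path[OF assms(1,2) d(1,2)]]
      cube_path_epath[OF assms(1,2) d(2)] ne assms(4) by (cases "is") auto
qed

text \<open>Reduction to corners: a corner of \<open>F\<close> and the corner of \<open>F'\<close>
  at the same place of the common cell are glued to the same vertex, hence equal. So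
  \<open>F'\<close> contains all corners of \<open>F\<close>.\<close>

lemma bd_face_le:
  assumes "c \<in> cells" "is_face (dim c) F" "is_face (dim c) F'" "bd c F = bd c F'"
  shows "face_le F F'"
proof -
  have below: "face_le z F'" if z: "corner (dim c) z" "face_le z F" for z
  proof -
    have "is_face (dim (bd c F')) (tr c F z)" using is_face_tr[OF assms(1,2)] assms(4) by simp
    then obtain z' where z': "is_face (dim c) z'" "face_le z' F'" "tr c F' z' = tr c F z"
      by (rule tr_surj[OF assms(1,3)])
    have "corner (dim c) z'"
      using fdim_tr[OF assms(1,3) z'(1,2)] fdim_tr[OF assms(1,2) corner_is_face[OF z(1)] z(2)]
        z' z(1) assms(4) by (simp add: corner_iff)
    moreover have "bd c z' = bd c z"
      using bd_bd[OF assms(1,3) z'(1,2)] bd_bd[OF assms(1,2) corner_is_face[OF z(1)] z(2)] z' assms(4)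
      by simp
    ultimately show ?thesis using bd_inj_corner[OF assms(1) z(1)] z'(2) by metis
  qed
  show ?thesis
    unfolding face_le_def
  proof (intro allI impI)
    fix i assume i: "F' i \<noteq> None"
    then have n: "i < dim c" using assms(3) by (metis is_face_def not_less)
    \<comment> \<open>The corner of \<open>F\<close> with all free coordinates set to
      \<open>b\<close>; comparing both values of \<open>b\<close> shows that \<open>F\<close> fixes
      \<open>i\<close>.\<close>
    let ?z = "\<lambda>b k. if k < dim c then (if F k = None then Some b else F k) else None"
    have "corner (dim c) (?z b)" "face_le (?z b) F" for b
      using assms(2) by (auto simp: corner_def is_face_def face_le_def not_less[symmetric])
    then have "face_le (?z b) F'" for b using below by blast
    then have *: "?z b i = F' i" for b using i by (auto simp only: face_le_def)
    show "F i = F' i"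
    proof (cases "F i = None")
      case True
      then have "Some True = Some False" using *[of True] *[of False] n by simp
      then show ?thesis by simp
    next
      case False
      then show ?thesis using *[of True] n by (simp only: if_True if_False)
    qed
  qed
qed

lemma bd_inj:
  assumes "c \<in> cells" "is_face (dim c) F" "is_face (dim c) F'" "bd c F = bd c F'"
  shows "F = F'"
  using bd_face_le[OF assms] bd_face_le[OF assms(1,3,2)] assms(4) face_le_antisym by simp

end

subsection \<open>Link edges are determined by their ends\<close>

lemma face_le_fdim_eq:
  assumes "is_face n f" "is_face n h" "face_le h f" "fdim n h = fdim n f" shows "h = f"
proof -
  have "{i. i < n \<and> h i = None} \<subseteq> {i. i < n \<and> f i = None}"
    using assms(3) unfolding face_le_def by force
  then have eq: "{i. i < n \<and> h i = None} = {i. i < n \<and> f i = None}"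
    using assms(4) unfolding fdim_def by (intro card_subset_eq) auto
  have "f i = h i" for i
  proof (cases "f i = None")
    case True
    then have "i < n \<Longrightarrow> h i = None" using eq by blast
    then show ?thesis using True assms(2) by (cases "i < n") (simp_all add: is_face_def)
  next
    case False
    then show ?thesis using assms(3) by (simp add: face_le_def)
  qed
  then show ?thesis by (intro ext) simp
qed

lemma iact_upd_None:
  assumes "is_ciso n phi" "i < n"
  obtains j where "j < n" "fst phi j = i" "\<And>f. iact n phi (f(i := None)) = (iact n phi f)(j := None)"
proof -
  have bij: "bij_betw (fst phi) {..<n} {..<n}" using assms(1) by (simp add: is_ciso_def)
  have "i \<in> fst phi ` {..<n}" using bij assms(2) by (simp add: bij_betw_def)
  then obtain j where j: "j < n" "fst phi j = i" by auto
  have eq: "fst phi k = i \<longleftrightarrow> k = j" if "k < n" for k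
    using bij that j by (auto simp: bij_betw_def inj_on_def)
  have "iact n phi (f(i := None)) k = ((iact n phi f)(j := None)) k" for f k
  proof (cases "k < n")
    case True
    then show ?thesis using eq[OF True] by (simp add: iact_def)
  next
    case False
    then show ?thesis using j(1) by (simp add: iact_def)
  qed
  then show thesis using that[OF j] by blast
qed

text \<open>Unlike in lk_end the order of the two ends is arbitrary: the order of the coordinates, by which
lk_end numbers them, is not preserved by automorphisms.\<close>

definition link_ends :: "'c cx \<Rightarrow> 'c \<times> face \<Rightarrow> 'c \<times> face \<Rightarrow> 'c \<times> face \<Rightarrow> bool" where
  "link_ends CX s u v \<longleftrightarrow> fst s \<in> cx_cells CX \<and> is_face (cx_dim CX (fst s)) (snd s) \<and>
    (\<exists>p q. p \<noteq> q \<and> {i. i < cx_dim CX (fst s) \<and> snd s i \<noteq> None} = {p, q} \<and>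
      u = lv CX (fst s) ((snd s)(p := None)) (snd s) \<and> v = lv CX (fst s) ((snd s)(q := None)) (snd s))"

lemma link_endsI:
  assumes "d \<in> cx_cells CX" "is_face (cx_dim CX d) f" "p \<noteq> q"
    "{i. i < cx_dim CX d \<and> f i \<noteq> None} = {p, q}"
  shows "link_ends CX (d, f) (lv CX d (f(p := None)) f) (lv CX d (f(q := None)) f)"
  unfolding link_ends_def using assms by (intro conjI exI[of _ p] exI[of _ q]) simp_all

lemma link_endsE:
  assumes "link_ends CX s u v"
  obtains d f p q where "s = (d, f)" "d \<in> cx_cells CX" "is_face (cx_dim CX d) f" "p \<noteq> q"
    "{i. i < cx_dim CX d \<and> f i \<noteq> None} = {p, q}"
    "u = lv CX d (f(p := None)) f" "v = lv CX d (f(q := None)) f"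
  using assms unfolding link_ends_def by (cases s) auto

lemma link_ends_sym:
  assumes "link_ends CX s u v" shows "link_ends CX s v u"
proof -
  obtain d f p q where s: "s = (d, f)" "d \<in> cx_cells CX" "is_face (cx_dim CX d) f" "p \<noteq> q"
    "{i. i < cx_dim CX d \<and> f i \<noteq> None} = {p, q}"
    "u = lv CX d (f(p := None)) f" "v = lv CX d (f(q := None)) f"
    using assms by (rule link_endsE)
  have "{i. i < cx_dim CX d \<and> f i \<noteq> None} = {q, p}" unfolding s(5) by (rule insert_commute)
  from link_endsI[OF s(2,3) s(4)[symmetric] this] show ?thesis unfolding s(1,6,7) .
qed

lemma link_ends_lk_end:
  assumes "fst s \<in> cx_cells CX" "is_face (cx_dim CX (fst s)) (snd s)"
    "cx_dim CX (fst s) = fdim (cx_dim CX (fst s)) (snd s) + 2"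
  shows "link_ends CX s (lk_end CX s 0) (lk_end CX s 1)"
proof -
  let ?n = "cx_dim CX (fst s)" let ?xs = "filter (\<lambda>i. snd s i \<noteq> None) [0..<?n]"
  have "card {i. i < ?n \<and> snd s i \<noteq> None} + fdim ?n (snd s) =
      card ({i. i < ?n \<and> snd s i \<noteq> None} \<union> {i. i < ?n \<and> snd s i = None})"
    unfolding fdim_def by (rule card_Un_disjoint[symmetric]) auto
  also have "{i. i < ?n \<and> snd s i \<noteq> None} \<union> {i. i < ?n \<and> snd s i = None} = {..<?n}" by auto
  finally have "card {i. i < ?n \<and> snd s i \<noteq> None} + fdim ?n (snd s) = ?n" by simp
  then have "length ?xs = 2" using assms(3) by (simp add: length_filter_upt)
  then obtain p q where pq: "?xs = [p, q]"
    by (auto simp: numeral_2_eq_2 length_Suc_conv)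
  then have "distinct [p, q]" by (metis distinct_filter distinct_upt)
  moreover have "{i. i < ?n \<and> snd s i \<noteq> None} = {p, q}"
    using arg_cong[OF pq, of set] by (auto simp: conj_commute)
  moreover have "lk_end CX s 0 = lv CX (fst s) ((snd s)(p := None)) (snd s)"
    "lk_end CX s 1 = lv CX (fst s) ((snd s)(q := None)) (snd s)"
    unfolding lk_end_def pq by simp_all
  ultimately show ?thesis using link_endsI[OF assms(1,2), of p q] by simp
qed

context cube_cx
begin

text \<open>The cell of a face contributes to the link of a corner the subsimplex spanned by its
  free directions. \<open>tr_index\<close> gives one inclusion, and invertibility of the numbering
  of free coordinates the other.\<close>

lemma svert_tr:
  assumes c: "c \<in> cells" and F: "is_face (dim c) F" and z: "corner (dim c) z" "face_le z F"
  shows "svert CX (bd c F, tr c F z) = (\<lambda>i. lnk (dE c z i)) ` {i. i < dim c \<and> F i = None}"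
proof -
  let ?s = "fst (cx_gl CX c F)" let ?k = "fdim (dim c) F"
  have bij: "bij_betw ?s {..<?k} {..<?k}" using ciso_gl[OF c F] by (simp add: is_ciso_def)
  have sv: "svert CX (bd c F, tr c F z) = (\<lambda>i. lnk (dE (bd c F) (tr c F z) i)) ` {..<?k}"
    using svert_dE[OF bd_cells[OF c F] corner_tr[OF c F z]] dim_bd[OF c F] by simp
  have ex: "\<exists>i'<?k. free_nth (dim c) F (?s i') = i \<and> dE (bd c F) (tr c F z) i' = dE c z i"
    if i: "i < dim c" "F i = None" for i
  proof -
    obtain i' where "i' < dim (bd c F)" "free_nth (dim c) F (?s i') = i"
      "\<And>z. tr c F (z(i := None)) = (tr c F z)(i' := None)" "\<And>z. tr c F (flip z i) = flip (tr c F z) i'"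
      by (rule tr_index[OF c F i]) auto
    then show ?thesis using dE_tr[OF c F z i] dim_bd[OF c F] by metis
  qed
  have ex': "\<exists>i<dim c. F i = None \<and> dE (bd c F) (tr c F z) j = dE c z i" if j: "j < ?k" for j
  proof -
    have sj: "?s j < ?k" using bij j by (auto simp: bij_betw_def)
    let ?i = "free_nth (dim c) F (?s j)"
    have i: "?i < dim c" "F ?i = None" using free_nth[OF sj] by auto
    obtain i' where i': "i' < ?k" "free_nth (dim c) F (?s i') = ?i"
      "dE (bd c F) (tr c F z) i' = dE c z ?i" using ex[OF i] by blast
    have "?s i' < ?k" using bij i'(1) by (auto simp: bij_betw_def)
    then have "?s i' = ?s j" using i'(2) free_rank_nth[OF sj] free_rank_nth[of "?s i'"] by metis
    then have "i' = j" using bij i'(1) j by (auto simp: bij_betw_def inj_on_def)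
    then show ?thesis using i i'(3) by blast
  qed
  show ?thesis
    unfolding sv
  proof (intro equalityI image_subsetI)
    fix j assume "j \<in> {..<?k}"
    then obtain i where "i < dim c" "F i = None" "dE (bd c F) (tr c F z) j = dE c z i"
      using ex' by blast
    then show "lnk (dE (bd c F) (tr c F z) j) \<in> (\<lambda>i. lnk (dE c z i)) ` {i. i < dim c \<and> F i = None}"
      by simp
  next
    fix i assume "i \<in> {i. i < dim c \<and> F i = None}"
    then obtain j where "j < ?k" "dE c z i = dE (bd c F) (tr c F z) j" using ex[of i] by auto
    then show "lnk (dE c z i) \<in> (\<lambda>i. lnk (dE (bd c F) (tr c F z) i)) ` {..<?k}" by simp
  qed
qed

text \<open>Agreement of corners in the base cell lifts to the end cubes: by \<open>tr_tr\<close>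
  both corners have the same image in the base cell, and the transport to it is injective.\<close>

lemma lv_corner_eq:
  assumes d: "d \<in> cells" "is_face (dim d) A" "is_face (dim d) f" "face_le f A" "corner (dim d) z" "face_le z f"
    and e: "e \<in> cells" "is_face (dim e) B" "is_face (dim e) g" "face_le g B" "corner (dim e) y" "face_le y g"
    and eq: "lv CX d A f = lv CX e B g" and w: "tr d f z = tr e g y"
  shows "lv CX d A z = lv CX e B y"
proof -
  have a: "bd d A = bd e B" "tr d A f = tr e B g" using eq by (simp_all add: lv_transport)
  have zA: "face_le z A" "face_le y B" using d(4,6) e(4,6) face_le_trans by blast+
  note z = corner_is_face[OF d(5)] and y = corner_is_face[OF e(5)]
  have "tr (bd d A) (tr d A f) (tr d A z) = tr (bd d A) (tr d A f) (tr e B y)"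
    using tr_tr[OF d(1,2) z d(6) d(3,4)] tr_tr[OF e(1,2) y e(6) e(3,4)] w a by simp
  then have "tr d A z = tr e B y"
  proof (rule tr_inj[rotated -1])
    show "bd d A \<in> cells" using bd_cells d by blast
    show "is_face (dim (bd d A)) (tr d A f)" "is_face (dim (bd d A)) (tr d A z)"
      using is_face_tr d by blast+
    show "is_face (dim (bd d A)) (tr e B y)" using is_face_tr[OF e(1,2)] a by simp
    show "face_le (tr d A z) (tr d A f)" using tr_le_iff[OF d(1,2) z d(3) zA(1) d(4)] d(6) by simp
    show "face_le (tr e B y) (tr d A f)" using tr_le_iff[OF e(1,2) y e(3) zA(2) e(4)] e(6) a by simp
  qed
  then show ?thesis using a by (simp add: lv_transport)
qed

lemma corner_below:
  assumes "is_face n f" obtains z where "corner n z" "face_le z f"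
proof -
  let ?z = "\<lambda>k. if k < n then (if f k = None then Some True else f k) else None"
  show thesis
    by (rule that[of ?z])
      (use assms in \<open>auto simp: corner_def is_face_def face_le_def not_less[symmetric]\<close>)
qed

end

context cat0_cx
begin

text \<open>At a common corner of the base cell, the two end cubes together contain every edge of
  the spanning cube. Hence the two spanning cubes give simplices of one vertex link with equal
  vertex sets and coincide; \<open>bd_inj\<close> then identifies the faces.\<close>

lemma link_ends_unique:
  assumes "link_ends CX s u v" "link_ends CX t u v" shows "s = t"
proof -
  obtain d f p q where s: "s = (d, f)" "d \<in> cells" "is_face (dim d) f" "p \<noteq> q"
    "{i. i < dim d \<and> f i \<noteq> None} = {p, q}"
    "u = lv CX d (f(p := None)) f" "v = lv CX d (f(q := None)) f"
    using assms(1) by (rule link_endsE)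
  obtain e g p' q' where t: "t = (e, g)" "e \<in> cells" "is_face (dim e) g" "p' \<noteq> q'"
    "{i. i < dim e \<and> g i \<noteq> None} = {p', q'}"
    "u = lv CX e (g(p' := None)) g" "v = lv CX e (g(q' := None)) g"
    using assms(2) by (rule link_endsE)
  have lt: "p < dim d" "q < dim d" "p' < dim e" "q' < dim e" using s(5) t(5) by blast+
  have face: "is_face (dim d) (f(p := None))" "is_face (dim d) (f(q := None))"
    "is_face (dim e) (g(p' := None))" "is_face (dim e) (g(q' := None))"
    using s(3) t(3) lt by (simp_all add: is_face_upd)
  have bd: "bd d f = bd e g"
    using bd_bd[OF s(2) face(1) s(3) face_le_upd_None] bd_bd[OF t(2) face(3) t(3) face_le_upd_None]
      s(6) t(6) by (simp add: lv_transport)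
  obtain z where z: "corner (dim d) z" "face_le z f" by (rule corner_below[OF s(3)])
  have "is_face (dim (bd e g)) (tr d f z)" using is_face_tr[OF s(2,3)] bd by simp
  then obtain y where y: "is_face (dim e) y" "face_le y g" "tr e g y = tr d f z"
    by (rule tr_surj[OF t(2,3)])
  have cy: "corner (dim e) y"
    using fdim_tr[OF t(2,3) y(1,2)] fdim_tr[OF s(2,3) corner_is_face[OF z(1)] z(2)] y z bd
    by (simp add: corner_iff)
  have eq: "lv CX d (f(p := None)) z = lv CX e (g(p' := None)) y"
    "lv CX d (f(q := None)) z = lv CX e (g(q' := None)) y"
    by (rule lv_corner_eq[OF s(2) face(1) s(3) _ z t(2) face(3) t(3) _ cy y(2)]; use s t y in simp)
      (rule lv_corner_eq[OF s(2) face(2) s(3) _ z t(2) face(4) t(3) _ cy y(2)]; use s t y in simp)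
  \<comment> \<open>Only \<open>i\<close> and \<open>j\<close> are fixed in \<open>h\<close>, and
    each end frees one of them, so every direction of \<open>c\<close> is free in at least one
    end.\<close>
  have cover: "svert CX (c, x) = svert CX (lv CX c (h(i := None)) x) \<union> svert CX (lv CX c (h(j := None)) x)"
    if c: "c \<in> cells" "is_face (dim c) h" "corner (dim c) x" "face_le x h" "i \<noteq> j"
      "{k. k < dim c \<and> h k \<noteq> None} = {i, j}" for c h x i j
  proof -
    have ij: "i < dim c" "j < dim c" using c(6) by blast+
    have le: "face_le x (h(i := None))" "face_le x (h(j := None))"
      using c(4) face_le_trans face_le_upd_None by blast+
    have "{..<dim c} = {k. k < dim c \<and> (h(i := None)) k = None} \<union> {k. k < dim c \<and> (h(j := None)) k = None}"
      using c(5,6) by auto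
    then show ?thesis
      unfolding lv_transport svert_tr[OF c(1) is_face_upd[OF c(2) ij(1)] c(3) le(1)]
        svert_tr[OF c(1) is_face_upd[OF c(2) ij(2)] c(3) le(2)] svert_dE[OF c(1,3)]
      by (simp only: image_Un)
  qed
  have "svert CX (d, z) = svert CX (e, y)"
    using cover[OF s(2,3) z s(4,5)] cover[OF t(2,3) cy y(2) t(4,5)] eq by simp
  moreover have "bd d z = bd e y"
    using bd_bd[OF s(2,3) corner_is_face[OF z(1)] z(2)] bd_bd[OF t(2,3) y(1,2)] bd y(3) by simp
  then have "vsimp CX (bd d z) (d, z)" "vsimp CX (bd d z) (e, y)"
    using s(2) t(2) z(1) cy lt by (simp_all add: vsimp_iff)
  ultimately have "d = e" using simplex_unique by blast
  then show ?thesis using bd_inj[OF s(2,3)] t(3) bd s(1) t(1) by simp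
qed

text \<open>The ends need only agree as cubes: a face of d contained in both end cubes lies in their
intersection, because distinct faces of d are glued to distinct cells.\<close>

lemma link_ends_cells_unique:
  assumes "link_ends CX s u v" "link_ends CX t u' v'" "fst u' = fst u" "fst v' = fst v"
  shows "s = t"
proof -
  obtain d f p q where s: "s = (d, f)" "d \<in> cells" "is_face (dim d) f" "p \<noteq> q"
    "{i. i < dim d \<and> f i \<noteq> None} = {p, q}"
    "u = lv CX d (f(p := None)) f" "v = lv CX d (f(q := None)) f"
    using assms(1) by (rule link_endsE)
  obtain e g p' q' where t: "t = (e, g)" "e \<in> cells" "is_face (dim e) g" "p' \<noteq> q'"
    "{i. i < dim e \<and> g i \<noteq> None} = {p', q'}"
    "u' = lv CX e (g(p' := None)) g" "v' = lv CX e (g(q' := None)) g"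
    using assms(2) by (rule link_endsE)
  let ?A = "f(p := None)" let ?B = "f(q := None)" let ?A' = "g(p' := None)" let ?B' = "g(q' := None)"
  have lt: "p < dim d" "q < dim d" "p' < dim e" "q' < dim e"
    and nn: "f p \<noteq> None" "f q \<noteq> None" "g p' \<noteq> None" "g q' \<noteq> None" using s(5) t(5) by blast+
  have face: "is_face (dim d) ?A" "is_face (dim d) ?B" "is_face (dim e) ?A'" "is_face (dim e) ?B'"
    using s(3) t(3) lt by (simp_all add: is_face_upd)
  have ab: "bd e ?A' = bd d ?A" "bd e ?B' = bd d ?B"
    using assms(3,4) s(6,7) t(6,7) by (simp_all add: lv_transport)
  have fd: "fdim (dim e) g = fdim (dim d) f"
    using arg_cong[OF ab(1), of dim] dim_bd[OF s(2) face(1)] dim_bd[OF t(2) face(3)]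
      fdim_upd_None[of p "dim d" f] fdim_upd_None[of p' "dim e" g] lt nn by simp
  have "is_face (dim (bd d ?A)) (tr e ?A' g)" "is_face (dim (bd d ?B)) (tr e ?B' g)"
    using is_face_tr[OF t(2) face(3)] is_face_tr[OF t(2) face(4)] ab by simp_all
  \<comment> \<open>\<open>H\<close> and \<open>H'\<close> are the base cube of \<open>t\<close>
    seen in \<open>d\<close> through the first and the second end cube; both are glued to
    \<open>bd e g\<close>, so they are equal.\<close>
  then obtain H H' where H: "is_face (dim d) H" "face_le H ?A" "tr d ?A H = tr e ?A' g"
    and H': "is_face (dim d) H'" "face_le H' ?B" "tr d ?B H' = tr e ?B' g"
    using tr_surj[OF s(2) face(1)] tr_surj[OF s(2) face(2)] by metis
  have "bd d H = bd e g" "bd d H' = bd e g"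
    using bd_bd[OF s(2) face(1) H(1,2)] bd_bd[OF s(2) face(2) H'(1,2)] H(3) H'(3)
      bd_bd[OF t(2) face(3) t(3)] bd_bd[OF t(2) face(4) t(3)] ab by simp_all
  then have HH: "H = H'" using bd_inj[OF s(2) H(1) H'(1)] by simp
  have "face_le H f"
    unfolding face_le_def
  proof (intro allI impI)
    fix k assume "f k \<noteq> None"
    then have "?A k = f k \<and> ?A k \<noteq> None \<or> ?B k = f k \<and> ?B k \<noteq> None" using s(4) by auto
    then show "H k = f k" using H(2) H'(2) HH unfolding face_le_def by metis
  qed
  moreover have "fdim (dim d) H = fdim (dim d) f"
    using fdim_tr[OF s(2) face(1) H(1,2)] fdim_tr[OF t(2) face(3) t(3)] H(3) ab fd by simp
  ultimately have "H = f" using face_le_fdim_eq[OF s(3) H(1)] by simp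
  then have "u = u'" "v = v'"
    using H(3) H'(3) HH ab s(6,7) t(6,7) by (simp_all add: lv_transport)
  then show ?thesis using link_ends_unique assms(1,2) by blast
qed

end

subsection \<open>The group action\<close>

locale cat0_action = cat0_cx CX + group G
  for CX :: "'c cx" and G :: "('g, 'b) monoid_scheme" (structure) +
  fixes act :: "'g \<Rightarrow> 'c \<Rightarrow> 'c" and aiso :: "'g \<Rightarrow> 'c \<Rightarrow> ciso"
  assumes action: "cube_action G CX act aiso"
begin

definition flag_act :: "'g \<Rightarrow> 'c \<times> face \<Rightarrow> 'c \<times> face" where
  "flag_act g s = (act g (fst s), iact (dim (fst s)) (aiso g (fst s)) (snd s))"

text \<open>A flag here is a cube with a chosen face, unrelated to the flag condition on
  links.\<close>

definition is_flag :: "'c \<times> face \<Rightarrow> bool" where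
  "is_flag s \<longleftrightarrow> fst s \<in> cells \<and> is_face (dim (fst s)) (snd s)"

lemma act_cells:
  assumes "g \<in> carrier G" "c \<in> cells"
  shows "act g c \<in> cells" "dim (act g c) = dim c" "is_ciso (dim c) (aiso g c)"
  using action assms unfolding cube_action_def by blast+

lemma is_flag_act: "g \<in> carrier G \<Longrightarrow> is_flag s \<Longrightarrow> is_flag (flag_act g s)"
  by (simp add: is_flag_def flag_act_def act_cells)

lemma flag_act_one: "is_flag s \<Longrightarrow> flag_act \<one> s = s"
  using action unfolding cube_action_def is_flag_def flag_act_def by (simp add: prod_eq_iff)

lemma flag_act_mult:
  assumes "g \<in> carrier G" "h \<in> carrier G" "is_flag s"
  shows "flag_act (g \<otimes> h) s = flag_act g (flag_act h s)"
proof -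
  have "act (g \<otimes> h) (fst s) = act g (act h (fst s)) \<and>
      iact (dim (fst s)) (aiso (g \<otimes> h) (fst s)) (snd s) =
      iact (dim (fst s)) (aiso g (act h (fst s))) (iact (dim (fst s)) (aiso h (fst s)) (snd s))"
    using action assms unfolding cube_action_def is_flag_def by blast
  then show ?thesis using assms by (simp add: flag_act_def is_flag_def act_cells)
qed

lemma flag_act_inv:
  assumes "g \<in> carrier G" "is_flag s" "flag_act g s = t" shows "flag_act (inv g) t = s"
  using flag_act_mult[of "inv g" g s] assms flag_act_one by auto

lemma flag_act_lv:
  assumes g: "g \<in> carrier G" and c: "c \<in> cells" and F: "is_face (dim c) F" and H: "is_face (dim c) H" "face_le H F"
  shows "flag_act g (lv CX c F H) =
    lv CX (act g c) (iact (dim c) (aiso g c) F) (iact (dim c) (aiso g c) H)"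
proof -
  let ?n = "dim c" let ?k = "fdim ?n F" let ?A = "iact ?n (aiso g c)" let ?h = "uninc ?n F H"
  have *: "act g (bd c F) = bd (act g c) (?A F) \<and>
      iact ?k (aiso g (bd c F)) (iact ?k (cx_gl CX c F) ?h) =
        iact ?k (cx_gl CX (act g c) (?A F)) (uninc ?n (?A F) (?A (incl ?n F ?h)))"
    using action g c F is_face_uninc[of ?n F H] unfolding cube_action_def Let_def by blast
  show ?thesis
    using * incl_uninc[OF F H] act_cells[OF g c] fdim_iact[OF act_cells(3)[OF g c], of F] dim_bd[OF c F]
    by (simp add: flag_act_def lv_def)
qed

lemma link_ends_flag:
  assumes "link_ends CX s u v" shows "is_flag s" "is_flag u" "is_flag v"
proof -
  obtain d f p q where s: "s = (d, f)" "d \<in> cells" "is_face (dim d) f" "p \<noteq> q"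
    "{i. i < dim d \<and> f i \<noteq> None} = {p, q}"
    "u = lv CX d (f(p := None)) f" "v = lv CX d (f(q := None)) f"
    using assms by (rule link_endsE)
  have "p < dim d" "q < dim d" using s(5) by blast+
  then have "is_face (dim d) (f(p := None))" "is_face (dim d) (f(q := None))"
    using s(3) is_face_upd by blast+
  then show "is_flag s" "is_flag u" "is_flag v"
    using s bd_cells is_face_tr by (simp_all add: is_flag_def lv_transport)
qed

lemma link_ends_act:
  assumes "link_ends CX s u v" and g: "g \<in> carrier G"
  shows "link_ends CX (flag_act g s) (flag_act g u) (flag_act g v)"
proof -
  obtain d f p q where s: "s = (d, f)" "d \<in> cells" "is_face (dim d) f" "p \<noteq> q"
    "{i. i < dim d \<and> f i \<noteq> None} = {p, q}"
    "u = lv CX d (f(p := None)) f" "v = lv CX d (f(q := None)) f"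
    using assms(1) by (rule link_endsE)
  have lt: "p < dim d" "q < dim d" using s(5) by blast+
  note iso = act_cells(3)[OF g s(2)]
  let ?A = "iact (dim d) (aiso g d)" let ?s = "fst (aiso g d)"
  obtain p' where p': "p' < dim d" "?s p' = p" "\<And>h. ?A (h(p := None)) = (?A h)(p' := None)"
    using iact_upd_None[OF iso lt(1)] by blast
  obtain q' where q': "q' < dim d" "?s q' = q" "\<And>h. ?A (h(q := None)) = (?A h)(q' := None)"
    using iact_upd_None[OF iso lt(2)] by blast
  have inj: "inj_on ?s {..<dim d}" and im: "?s ` {..<dim d} = {..<dim d}"
    using iso by (simp_all add: is_ciso_def bij_betw_def)
  have "i < dim d \<and> ?A f i \<noteq> None \<longleftrightarrow> i \<in> {p', q'}" for i
  proof (cases "i < dim d")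
    case True
    have "?A f i \<noteq> None \<longleftrightarrow> f (?s i) \<noteq> None" using True by (simp add: iact_def)
    also have "\<dots> \<longleftrightarrow> ?s i \<in> {i. i < dim d \<and> f i \<noteq> None}" using True im by auto
    also have "\<dots> \<longleftrightarrow> ?s i = ?s p' \<or> ?s i = ?s q'" unfolding s(5) p'(2) q'(2) by simp
    also have "\<dots> \<longleftrightarrow> i \<in> {p', q'}"
      using inj_on_eq_iff[OF inj, of i] True p'(1) q'(1) by simp
    finally show ?thesis using True by simp
  next
    case False
    then show ?thesis using p'(1) q'(1) by auto
  qed
  then have fixed: "{i. i < dim (act g d) \<and> ?A f i \<noteq> None} = {p', q'}"
    using act_cells[OF g s(2)] by auto
  have "p' \<noteq> q'" using p'(2) q'(2) s(4) by auto
  moreover have "is_face (dim (act g d)) (?A f)" using act_cells[OF g s(2)] by simp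
  ultimately have "link_ends CX (act g d, ?A f)
      (lv CX (act g d) ((?A f)(p' := None)) (?A f)) (lv CX (act g d) ((?A f)(q' := None)) (?A f))"
    by (intro link_endsI act_cells(1)[OF g s(2)] fixed)
  then show ?thesis
    using flag_act_lv[OF g s(2) is_face_upd[OF s(3) lt(1)] s(3) face_le_upd_None]
      flag_act_lv[OF g s(2) is_face_upd[OF s(3) lt(2)] s(3) face_le_upd_None] s(1,6,7) p'(3) q'(3)
    by (simp add: flag_act_def)
qed

lemma finite_link_ends: "finite {(u, v). link_ends CX s u v}"
proof -
  let ?l = "\<lambda>p. lv CX (fst s) ((snd s)(p := None)) (snd s)"
  have "{(u, v). link_ends CX s u v} \<subseteq> (\<lambda>(p, q). (?l p, ?l q)) ` ({..<dim (fst s)} \<times> {..<dim (fst s)})"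
  proof safe
    fix u v u1 v1 assume "link_ends CX s (u, u1) (v, v1)"
    then obtain d f p q where s: "s = (d, f)" "{i. i < dim d \<and> f i \<noteq> None} = {p, q}"
      "(u, u1) = ?l p" "(v, v1) = ?l q"
      by (rule link_endsE) auto
    have "p < dim d" "q < dim d" using s(2) by blast+
    then show "((u, u1), v, v1) \<in> (\<lambda>(p, q). (?l p, ?l q)) ` ({..<dim (fst s)} \<times> {..<dim (fst s)})"
      using s by (intro image_eqI[of _ _ "(p, q)"]) simp_all
  qed
  then show ?thesis by (rule finite_subset) simp
qed

text \<open>There are finitely many orbits of cubes and each cube has finitely many faces;
  \<open>iact_surj\<close> pulls the face of a translate back to the representative.\<close>

lemma finite_flag_representatives:
  assumes "cocompact G CX act"
  obtains R where "finite R" "\<And>s. is_flag s \<Longrightarrow> \<exists>g\<in>carrier G. \<exists>r\<in>R. is_flag r \<and> s = flag_act g r"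
proof -
  let ?orb = "\<lambda>c. (\<lambda>g. act g c) ` carrier G"
  obtain C where C: "C \<subseteq> cells" "finite C" "?orb ` cells = ?orb ` C"
    using assms finite_subset_image[of "?orb ` cells" ?orb cells] unfolding cocompact_def by blast
  define R where "R = (SIGMA c:C. {f. is_face (dim c) f})"
  have "finite R" unfolding R_def using C(2) finite_faces by blast
  moreover have "\<exists>g\<in>carrier G. \<exists>r\<in>R. is_flag r \<and> s = flag_act g r" if s: "is_flag s" for s
  proof -
    have c: "fst s \<in> cells" "is_face (dim (fst s)) (snd s)" using s by (simp_all add: is_flag_def)
    have "act \<one> (fst s) = fst s" using flag_act_one[OF s] by (simp add: flag_act_def prod_eq_iff)
    then have "fst s \<in> ?orb (fst s)" using one_closed by (metis imageI)
    moreover have "?orb (fst s) \<in> ?orb ` C" unfolding C(3)[symmetric] using c(1) by (rule imageI)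
    then obtain c0 where "?orb (fst s) = ?orb c0" and c0: "c0 \<in> C" by (rule imageE)
    ultimately have "fst s \<in> ?orb c0" by simp
    then obtain g where g: "fst s = act g c0" "g \<in> carrier G" by (rule imageE)
    have cell: "c0 \<in> cells" using C(1) c0 by blast
    note a = act_cells[OF g(2) cell]
    obtain f where f: "is_face (dim c0) f" "iact (dim c0) (aiso g c0) f = snd s"
      using iact_surj[OF a(3)] c(2) g(1) a(2) by metis
    have "(c0, f) \<in> R" "is_flag (c0, f)" "s = flag_act g (c0, f)"
      using c0 f cell g(1) by (simp_all add: R_def is_flag_def flag_act_def prod_eq_iff)
    then show ?thesis using g(2) by blast
  qed
  ultimately show thesis using that by blast
qed

lemma flag_act_stab:
  assumes "g \<in> carrier G" "flag_act g u = u" shows "g \<in> cube_stab G act (fst u)"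
  using assms by (simp add: cube_stab_def flag_act_def prod_eq_iff)

lemma fst_flag_act: "fst (flag_act g s) = act g (fst s)"
  by (simp add: flag_act_def)

lemma same_orbit_iff: "same_orbit H CX act aiso s t \<longleftrightarrow> (\<exists>k\<in>H. flag_act k s = t)"
  by (auto simp: same_orbit_def flag_act_def prod_eq_iff)

lemma act_inv_stab:
  assumes "g \<in> cube_stab G act c" "c \<in> cells" shows "act (inv g) c = c"
proof -
  have g: "g \<in> carrier G" "act g c = c" using assms(1) by (simp_all add: cube_stab_def)
  have "act (inv g \<otimes> g) c = act (inv g) (act g c)" "act \<one> c = c"
    using action g(1) assms(2) unfolding cube_action_def by (meson inv_closed)+
  then show ?thesis using g by simp
qed

lemma act_mult: "g \<in> carrier G \<Longrightarrow> h \<in> carrier G \<Longrightarrow> c \<in> cells \<Longrightarrow> act (g \<otimes> h) c = act g (act h c)"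
  using action unfolding cube_action_def by blast

text \<open>If r = q1 p q2, then q1 p carries t to a link edge whose end cubes are those of s.\<close>

lemma link_edge_orbit:
  assumes ends: "link_ends CX s u v" "link_ends CX t u' v'"
    and p: "p \<in> carrier G" "flag_act p u' = u" and r: "r \<in> carrier G" "flag_act r v' = v"
    and one: "\<one> \<in> prod4 G (inv r) (cube_stab G act (fst u)) p (cube_stab G act (fst v'))"
  shows "\<exists>h\<in>carrier G. s = flag_act h t"
proof -
  obtain q1 q2 where q1: "q1 \<in> cube_stab G act (fst u)" and q2: "q2 \<in> cube_stab G act (fst v')"
    and eq: "\<one> = inv r \<otimes> q1 \<otimes> p \<otimes> q2"
    using one unfolding prod4_def by blast
  have G: "q1 \<in> carrier G" "q2 \<in> carrier G" using q1 q2 by (simp_all add: cube_stab_def)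
  have cells: "fst u' \<in> cells" "fst v' \<in> cells"
    using link_ends_flag[OF ends(2)] by (simp_all add: is_flag_def)
  have "inv r \<otimes> (q1 \<otimes> p \<otimes> q2) = \<one>" using eq G p(1) r(1) by (simp add: m_assoc)
  then have "r = q1 \<otimes> p \<otimes> q2" using G p(1) r(1)
    by (metis inv_closed inv_comm inv_equality inv_inv m_closed)
  \<comment> \<open>The left side shows that this element carries the cube of \<open>u'\<close> to
    that of \<open>u\<close>, the right side that it carries the cube of \<open>v'\<close> to that
    of \<open>v\<close>.\<close>
  then have h: "q1 \<otimes> p = r \<otimes> inv q2" using G p(1) by (simp add: m_assoc)
  have "fst (flag_act (q1 \<otimes> p) u') = fst u"
    using act_mult[OF G(1) p(1) cells(1)] p(2) q1 by (auto simp: fst_flag_act cube_stab_def)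
  moreover have "fst (flag_act (q1 \<otimes> p) v') = fst v"
    unfolding h using act_mult[OF r(1) inv_closed[OF G(2)] cells(2)] act_inv_stab[OF q2 cells(2)] r(2)
    by (auto simp: fst_flag_act)
  ultimately have "s = flag_act (q1 \<otimes> p) t"
    using link_ends_cells_unique[OF ends(1) link_ends_act[OF ends(2), of "q1 \<otimes> p"]] G p(1) by simp
  then show ?thesis using G p(1) by blast
qed

text \<open>With \<open>x\<close> and \<open>y\<close> the elements carrying \<open>u'\<close> to
  \<open>u\<close> and \<open>v'\<close> to \<open>v\<close>, take \<open>x p^-1\<close> and
  \<open>y^-1 r\<close> as stabilizer elements. The product collapses to
  \<open>r^-1 x y^-1 r\<close>; since \<open>g2\<close> cancels, \<open>x y^-1\<close> is a
  conjugate of \<open>k^-1 l\<close>, so normality puts everything into \<open>K\<close>.\<close>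

lemma normal_conj_mem_prod4:
  assumes K: "normal K G" and k: "k \<in> K" "l \<in> K" and g: "g1 \<in> carrier G" "g2 \<in> carrier G"
    and u: "is_flag u" "is_flag u'" "flag_act (inv g1 \<otimes> inv k \<otimes> g2) u' = u"
    and v: "is_flag v" "is_flag v'" "flag_act (inv g1 \<otimes> inv l \<otimes> g2) v' = v"
    and p: "p \<in> carrier G" "flag_act p u' = u" and r: "r \<in> carrier G" "flag_act r v' = v"
  shows "K \<inter> prod4 G (inv r) (cube_stab G act (fst u)) p (cube_stab G act (fst v')) \<noteq> {}"
proof -
  interpret K: normal K G by (rule K)
  have kl: "k \<in> carrier G" "l \<in> carrier G" using k K.mem_carrier by blast+
  define x where "x = inv g1 \<otimes> inv k \<otimes> g2"
  define y where "y = inv g1 \<otimes> inv l \<otimes> g2"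
  have xy: "x \<in> carrier G" "y \<in> carrier G" unfolding x_def y_def using kl g by simp_all
  let ?q1 = "x \<otimes> inv p" let ?q2 = "inv y \<otimes> r"
  have "flag_act ?q1 u = u"
    using flag_act_mult[OF xy(1) inv_closed[OF p(1)] u(1)] flag_act_inv[OF p(1) u(2) p(2)] u(3) x_def by simp
  then have q1: "?q1 \<in> cube_stab G act (fst u)" using flag_act_stab xy p by simp
  have "flag_act ?q2 v' = v'"
    using flag_act_mult[OF inv_closed[OF xy(2)] r(1) v(2)] flag_act_inv[OF xy(2) v(2)] v(3) r(2) y_def by simp
  then have q2: "?q2 \<in> cube_stab G act (fst v')" using flag_act_stab xy r by simp
  have "x \<otimes> inv y = inv g1 \<otimes> (inv k \<otimes> l) \<otimes> g1"
  proof -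
    have "g2 \<otimes> (inv g2 \<otimes> (l \<otimes> g1)) = l \<otimes> g1" using kl g by (simp add: m_assoc[symmetric])
    then show ?thesis unfolding x_def y_def using kl g by (simp add: inv_mult_group m_assoc)
  qed
  moreover have "inv k \<otimes> l \<in> K" using k by (simp add: K.m_closed K.m_inv_closed)
  ultimately have "x \<otimes> inv y \<in> K" using K.inv_op_closed1[OF g(1)] by simp
  then have "inv r \<otimes> (x \<otimes> inv y) \<otimes> r \<in> K" using K.inv_op_closed1[OF r(1)] by simp
  moreover have "inv r \<otimes> ?q1 \<otimes> p \<otimes> ?q2 = inv r \<otimes> (x \<otimes> inv y) \<otimes> r"
  proof -
    have "?q1 \<otimes> p = x" using xy p(1) by (simp add: m_assoc)
    then have "inv r \<otimes> ?q1 \<otimes> p = inv r \<otimes> x" using xy p(1) r(1) by (simp add: m_assoc)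
    then show ?thesis using xy r(1) by (simp add: m_assoc)
  qed
  moreover have "inv r \<otimes> ?q1 \<otimes> p \<otimes> ?q2 \<in>
      prod4 G (inv r) (cube_stab G act (fst u)) p (cube_stab G act (fst v'))"
    unfolding prod4_def using q1 q2 by (intro CollectI exI[of _ ?q1] exI[of _ ?q2]) simp
  ultimately show ?thesis by (metis IntI emptyE)
qed

lemma finite_obstruction:
  assumes "cocompact G CX act"
  shows "\<exists>F2. finite F2 \<and>
           F2 \<subseteq> cube_stabs G CX act \<times> cube_stabs G CX act \<times> carrier G \<times> carrier G \<and>
           (\<forall>(Q1, Q2, p1, p2) \<in> F2. \<one> \<notin> prod4 G p1 Q1 p2 Q2) \<and>
           (\<forall>K. normal K G \<and> (\<forall>(Q1, Q2, p1, p2) \<in> F2. K \<inter> prod4 G p1 Q1 p2 Q2 = {})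
                \<longrightarrow> two_loops_same_orbit G CX act aiso K)"
proof -
  obtain R where R: "finite R"
    "\<And>s. is_flag s \<Longrightarrow> \<exists>g\<in>carrier G. \<exists>r\<in>R. is_flag r \<and> s = flag_act g r"
    using finite_flag_representatives[OF assms] by blast
  \<comment> \<open>Each representative occurs with both orders of its ends, as
    \<open>link_ends\<close> is symmetric in them.\<close>
  define E where "E = (SIGMA s:R. {(u, v). link_ends CX s u v})"
  \<comment> \<open>One fixed carrier element per pair of ends keeps the set of tuples finite; the
    value matters only when the ends lie in one orbit.\<close>
  define P where "P w w' = (SOME g. g \<in> carrier G \<and> flag_act g w' = w)" for w w'
  define tup where "tup u v u' v' =
    (cube_stab G act (fst u), cube_stab G act (fst v'), inv (P v v'), P u u')" for u v u' v'
  define good where "good x \<longleftrightarrow> (case x of (Q1, Q2, p1, p2) \<Rightarrow> \<one> \<notin> prod4 G p1 Q1 p2 Q2)"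
    for x :: "'g set \<times> 'g set \<times> 'g \<times> 'g"
  \<comment> \<open>Tuples whose product contains the identity are left out; for them
    \<open>link_edge_orbit\<close> gives the conclusion directly.\<close>
  define F2 where "F2 = {tup u v u' v' | s u v t u' v'. (s, u, v) \<in> E \<and> (t, u', v') \<in> E \<and>
    (\<exists>g\<in>carrier G. flag_act g u' = u) \<and> (\<exists>g\<in>carrier G. flag_act g v' = v) \<and> good (tup u v u' v')}"
  have P: "P w w' \<in> carrier G \<and> flag_act (P w w') w' = w"
    if "\<exists>g\<in>carrier G. flag_act g w' = w" for w w'
    unfolding P_def by (rule someI_ex) (use that in blast)
  have E: "link_ends CX s u v" if "(s, u, v) \<in> E" for s u v
    using that by (simp add: E_def)
  have "finite E" unfolding E_def using R(1) finite_link_ends by blast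
  then have "finite ((\<lambda>((s, u, v), (t, u', v')). tup u v u' v') ` (E \<times> E))" by simp
  moreover have "F2 \<subseteq> (\<lambda>((s, u, v), (t, u', v')). tup u v u' v') ` (E \<times> E)"
    unfolding F2_def by force
  ultimately have fin: "finite F2" by (rule rev_finite_subset)
  have sub: "F2 \<subseteq> cube_stabs G CX act \<times> cube_stabs G CX act \<times> carrier G \<times> carrier G"
  proof
    fix x assume "x \<in> F2"
    then obtain s u v t u' v' where x: "x = tup u v u' v'" "(s, u, v) \<in> E" "(t, u', v') \<in> E"
      "\<exists>g\<in>carrier G. flag_act g u' = u" "\<exists>g\<in>carrier G. flag_act g v' = v"
      unfolding F2_def by blast
    have "fst u \<in> cells" "fst v' \<in> cells"
      using link_ends_flag[OF E[OF x(2)]] link_ends_flag[OF E[OF x(3)]] by (simp_all add: is_flag_def)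
    then show "x \<in> cube_stabs G CX act \<times> cube_stabs G CX act \<times> carrier G \<times> carrier G"
      using P[OF x(4)] P[OF x(5)] x(1) by (simp add: tup_def cube_stabs_def)
  qed
  have one: "\<forall>(Q1, Q2, p1, p2) \<in> F2. \<one> \<notin> prod4 G p1 Q1 p2 Q2"
  proof
    fix x assume "x \<in> F2"
    then have "good x" unfolding F2_def by blast
    then show "case x of (Q1, Q2, p1, p2) \<Rightarrow> \<one> \<notin> prod4 G p1 Q1 p2 Q2" by (simp only: good_def)
  qed
  have loops: "two_loops_same_orbit G CX act aiso K"
    if K: "normal K G" and avoid: "\<forall>(Q1, Q2, p1, p2) \<in> F2. K \<inter> prod4 G p1 Q1 p2 Q2 = {}" for K
  proof -
    interpret K: normal K G by (rule K)
    have orbit: "\<exists>h\<in>carrier G. flag_act h \<sigma>1 = \<sigma>2"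
      if ends: "link_ends CX \<sigma>1 u1 v1" "link_ends CX \<sigma>2 u2 v2"
        and k: "k \<in> K" "flag_act k u1 = u2" and l: "l \<in> K" "flag_act l v1 = v2"
      for \<sigma>1 \<sigma>2 u1 v1 u2 v2 k l
    proof -
      note fl1 = link_ends_flag[OF ends(1)] and fl2 = link_ends_flag[OF ends(2)]
      obtain g1 s where g1: "g1 \<in> carrier G" and s: "s \<in> R" "is_flag s" "\<sigma>1 = flag_act g1 s"
        using R(2)[OF fl1(1)] by blast
      obtain g2 t where g2: "g2 \<in> carrier G" and t: "t \<in> R" "is_flag t" "\<sigma>2 = flag_act g2 t"
        using R(2)[OF fl2(1)] by blast
      define u where "u = flag_act (inv g1) u1"
      define v where "v = flag_act (inv g1) v1"
      define u' where "u' = flag_act (inv g2) u2"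
      define v' where "v' = flag_act (inv g2) v2"
      have "flag_act (inv g1) \<sigma>1 = s" "flag_act (inv g2) \<sigma>2 = t"
        using flag_act_inv[OF g1 s(2)] flag_act_inv[OF g2 t(2)] s(3) t(3) by simp_all
      then have e: "link_ends CX s u v" "link_ends CX t u' v'"
        using link_ends_act[OF ends(1) inv_closed[OF g1]] link_ends_act[OF ends(2) inv_closed[OF g2]]
        by (simp_all add: u_def v_def u'_def v'_def)
      have kl: "k \<in> carrier G" "l \<in> carrier G" using k(1) l(1) K.mem_carrier by blast+
      have pullback: "flag_act (inv g1 \<otimes> inv m \<otimes> g2) (flag_act (inv g2) w2) = flag_act (inv g1) w1"
        if "m \<in> carrier G" "is_flag w1" "flag_act m w1 = w2" for m w1 w2
      proof -
        have w2: "is_flag w2" using is_flag_act that by blast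
        have "flag_act g2 (flag_act (inv g2) w2) = w2"
          using flag_act_inv[OF inv_closed[OF g2] w2] g2 by simp
        then have "flag_act (inv g1 \<otimes> inv m \<otimes> g2) (flag_act (inv g2) w2) =
            flag_act (inv g1) (flag_act (inv m) w2)"
          using that(1) g1 g2 w2 by (simp add: flag_act_mult is_flag_act)
        then show ?thesis using flag_act_inv[OF that] by simp
      qed
      have x: "flag_act (inv g1 \<otimes> inv k \<otimes> g2) u' = u" "flag_act (inv g1 \<otimes> inv l \<otimes> g2) v' = v"
        using pullback[OF kl(1) fl1(2) k(2)] pullback[OF kl(2) fl1(3) l(2)]
        by (simp_all add: u_def v_def u'_def v'_def)
      have ex: "\<exists>g\<in>carrier G. flag_act g u' = u" "\<exists>g\<in>carrier G. flag_act g v' = v"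
        by (rule bexI, rule x(1), use kl g1 g2 in simp) (rule bexI, rule x(2), use kl g1 g2 in simp)
      note p = P[OF ex(1)] and r = P[OF ex(2)]
      note f = link_ends_flag[OF e(1)] link_ends_flag[OF e(2)]
      have "K \<inter> prod4 G (inv (P v v')) (cube_stab G act (fst u)) (P u u') (cube_stab G act (fst v')) \<noteq> {}"
        using normal_conj_mem_prod4[OF K k(1) l(1) g1 g2 f(2,5) x(1) f(3,6) x(2)] p r by blast
      \<comment> \<open>\<open>K\<close> meets the product, so the tuple is not in
        \<open>F2\<close>; as its other conditions hold, it must fail \<open>good\<close>.\<close>
      then have "tup u v u' v' \<notin> F2" using avoid by (auto simp: tup_def)
      moreover have "(s, u, v) \<in> E" "(t, u', v') \<in> E" using e s(1) t(1) by (simp_all add: E_def)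
      ultimately have "\<not> good (tup u v u' v')" using ex unfolding F2_def by blast
      then have "\<one> \<in> prod4 G (inv (P v v')) (cube_stab G act (fst u)) (P u u') (cube_stab G act (fst v'))"
        by (simp add: good_def tup_def)
      then obtain h where h: "h \<in> carrier G" "s = flag_act h t"
        using link_edge_orbit[OF e] p r by blast
      \<comment> \<open>Transfers \<open>s = flag_act h t\<close> back along \<open>g1\<close> and
        \<open>g2\<close> to the original link edges.\<close>
      have "flag_act (g2 \<otimes> inv h \<otimes> inv g1) \<sigma>1 = flag_act g2 (flag_act (inv h) (flag_act (inv g1) \<sigma>1))"
        using g1 g2 h(1) fl1(1) by (simp add: flag_act_mult is_flag_act)
      also have "\<dots> = flag_act g2 t"
        using \<open>flag_act (inv g1) \<sigma>1 = s\<close> flag_act_inv[OF h(1) t(2)] h(2) by simp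
      finally have "flag_act (g2 \<otimes> inv h \<otimes> inv g1) \<sigma>1 = \<sigma>2" using t(3) by simp
      then show ?thesis by (rule bexI) (use g1 g2 h(1) in simp)
    qed
    show ?thesis
      unfolding two_loops_same_orbit_def same_orbit_iff
    proof (intro ballI allI impI, elim conjE)
      fix c \<sigma>1 \<sigma>2
      assume lifts: "lk1_lift CX act K c \<sigma>1" "lk1_lift CX act K c \<sigma>2"
        and "(\<exists>k\<in>K. flag_act k (lk_end CX \<sigma>1 0) = lk_end CX \<sigma>2 0) \<and>
           (\<exists>k\<in>K. flag_act k (lk_end CX \<sigma>1 1) = lk_end CX \<sigma>2 1) \<or>
           (\<exists>k\<in>K. flag_act k (lk_end CX \<sigma>1 0) = lk_end CX \<sigma>2 1) \<and>
           (\<exists>k\<in>K. flag_act k (lk_end CX \<sigma>1 1) = lk_end CX \<sigma>2 0)"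
      moreover have ends: "link_ends CX \<sigma>1 (lk_end CX \<sigma>1 0) (lk_end CX \<sigma>1 1)"
        "link_ends CX \<sigma>2 (lk_end CX \<sigma>2 0) (lk_end CX \<sigma>2 1)"
        using lifts unfolding lk1_lift_def by (metis link_ends_lk_end)+
      \<comment> \<open>When the ends are matched crosswise, the ends of the second link edge are
        interchanged.\<close>
      ultimately show "\<exists>k\<in>carrier G. flag_act k \<sigma>1 = \<sigma>2"
        using orbit[OF ends] orbit[OF ends(1) link_ends_sym[OF ends(2)]] by blast
    qed
  qed
  show ?thesis
    by (intro exI[of _ F2] conjI allI impI fin sub one, elim conjE) (rule loops)
qed

end

theorem theorem5p7:
  fixes G :: "('g, 'b) monoid_scheme" and CX :: "'c cx"
    and act :: "'g \<Rightarrow> 'c \<Rightarrow> 'c" and aiso :: "'g \<Rightarrow> 'c \<Rightarrow> ciso"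
  assumes "cube_action G CX act aiso"
    and "cat0_cube_complex CX"
    and "cocompact G CX act"
  shows "\<exists>F2. finite F2 \<and>
           F2 \<subseteq> cube_stabs G CX act \<times> cube_stabs G CX act \<times> carrier G \<times> carrier G \<and>
           (\<forall>(Q1, Q2, p1, p2) \<in> F2. \<one>\<^bsub>G\<^esub> \<notin> prod4 G p1 Q1 p2 Q2) \<and>
           (\<forall>K. co_cubical G CX act aiso K \<and>
                (\<forall>(Q1, Q2, p1, p2) \<in> F2. K \<inter> prod4 G p1 Q1 p2 Q2 = {})
                \<longrightarrow> two_loops_same_orbit G CX act aiso K)"
proof -
  have cc: "cube_complex CX" "simply_connected CX" "flag_links CX"
    using assms(2) by (simp_all add: cat0_cube_complex_def)
  have "group G" using assms(1) by (simp add: cube_action_def)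
  then interpret cat0_action CX G act aiso
    by (intro cat0_action.intro cat0_cx.intro flag_cx.intro cube_cx.intro flag_cx_axioms.intro
        cat0_cx_axioms.intro cat0_action_axioms.intro cc assms(1))
  have normal: "normal K G" if "co_cubical G CX act aiso K" for K
    using that by (simp add: co_cubical_def)
  from finite_obstruction[OF assms(3)] show ?thesis
    by (elim exE conjE, intro exI conjI allI impI) (assumption | erule conjE allE impE | rule conjI normal)+
qed

end
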